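(* Let $f:\mathbb{S}^2\to\mathbb{R}^3$ be a sphere of revolution whose generating curve $c:[0,1]\to[0,\infty)\times\mathbb{R}$ has turning number $\tau\in\mathbb{Z}+\frac12$. If $f$ is not a round sphere, then $$W(f)>4\pi\left(|\tau|+\tfrac12\right).$$
   Context: For an immersion $f:\mathbb{S}^2\to\mathbb{R}^3$, $W(f)=\int_{\mathbb{S}^2} H^2\,d\mu_f$, where $\mu_f$ is the area measure induced by $f$ and $H=\frac12(\kappa_1+\kappa_2)$ is the mean curvature. A sphere of revolution is a smoothly immersed sphere that can be parametrized as $f(t,\varphi)=(r(t)\cos\varphi,r(t)\sin\varphi,h(t))$ for some regular curve $c=(r,h):[0,1]\to[0,\infty)\times\mathbb{R}$ (the generating curve) with $r(0)=r(1)=0$, $r(t)>0$ for all $t\in(0,1)$, and such that $c$ meets the symmetry axis $\{r=0\}$ perpendicularly. The turning number of $c$ is $\tau=\frac{1}{2\pi}(\vartheta(1)-\vartheta(0))$, where $\vartheta:[0,1]\to\mathbb{R}$ is a continuous lift of the tangent angle of $c$. A round sphere is an immersion obtained from the standard embedding $\mathbb{S}^2\to\mathbb{R}^3$ by reparametrization, scaling and translation. *)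

theory Defs
  imports "HOL-Analysis.Analysis"
begin

subsection \<open>Smoothness\<close>

text \<open>\<open>Ck_on k U f\<close> is meant for open \<open>U\<close>: all iterated directional derivatives of order up to
  \<open>k\<close> exist as Frechet derivatives and are continuous on \<open>U\<close>.\<close>

primrec Ck_on ::
  "nat \<Rightarrow> 'a::real_normed_vector set \<Rightarrow> ('a \<Rightarrow> 'b::real_normed_vector) \<Rightarrow> bool" where
  "Ck_on 0 U f \<longleftrightarrow> continuous_on U f"
| "Ck_on (Suc k) U f \<longleftrightarrow> (\<forall>x\<in>U. f differentiable (at x)) \<and>
     (\<forall>v. Ck_on k U (\<lambda>x. frechet_derivative f (at x) v))"

text \<open>Smoothness on an arbitrary subset (here: the closed interval \<open>[0,1]\<close>, the unit sphere)
  means existence of a smooth extension to an open neighbourhood.\<close>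

definition smooth_on :: "'a::real_normed_vector set \<Rightarrow> ('a \<Rightarrow> 'b::real_normed_vector) \<Rightarrow> bool" where
  "smooth_on S f \<longleftrightarrow> (\<exists>U g. open U \<and> S \<subseteq> U \<and> (\<forall>k. Ck_on k U g) \<and> (\<forall>x\<in>S. g x = f x))"

subsection \<open>Immersions of the unit sphere into three-space\<close>

text \<open>A map on the sphere \<open>sphere 0 1\<close> is represented by a total function \<open>f\<close> of which only the values
  on the sphere matter. Derivatives are computed from the radially constant extension
  \<open>\<lambda>x. f (sgn x)\<close>, where \<open>sgn x = x / norm x\<close>.\<close>

definition sphere_tangent :: "real^3 \<Rightarrow> (real^3) set" where
  "sphere_tangent p = {v. v \<bullet> p = 0}"

definition sphere_diff :: "(real^3 \<Rightarrow> real^3) \<Rightarrow> real^3 \<Rightarrow> real^3 \<Rightarrow> real^3" where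
  "sphere_diff f p v = frechet_derivative (\<lambda>x. f (sgn x)) (at p) v"

definition sphere_immersion :: "(real^3 \<Rightarrow> real^3) \<Rightarrow> bool" where
  "sphere_immersion f \<longleftrightarrow> smooth_on (sphere 0 1) f \<and>
     (\<forall>p\<in>sphere 0 1. inj_on (sphere_diff f p) (sphere_tangent p))"

text \<open>\<open>(u, cross3 p u)\<close> is a positively oriented orthonormal basis of the tangent space at \<open>p\<close>.
  The vector \<open>normal_vec f p\<close> does not depend on the choice of \<open>u\<close>; its direction is the unit
  normal of \<open>f\<close> and its length is the Jacobian of \<open>f\<close>, i.e. the area distortion.\<close>

definition normal_vec :: "(real^3 \<Rightarrow> real^3) \<Rightarrow> real^3 \<Rightarrow> real^3" where
  "normal_vec f p =
     (let u = (SOME u. norm u = 1 \<and> u \<in> sphere_tangent p)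
      in cross3 (sphere_diff f p u) (sphere_diff f p (cross3 p u)))"

definition first_fund :: "(real^3 \<Rightarrow> real^3) \<Rightarrow> real^3 \<Rightarrow> real^3 \<Rightarrow> real^3 \<Rightarrow> real" where
  "first_fund f p v w = sphere_diff f p v \<bullet> sphere_diff f p w"

text \<open>For a curve \<open>\<gamma>\<close> in the sphere with \<open>\<gamma>(0) = p\<close> and \<open>\<gamma>'(0) = v\<close>, the normal component of
  \<open>(f \<circ> \<gamma>)''(0)\<close> is the normal component of the second derivative of the radial extension of \<open>f\<close> at
  \<open>p\<close> in direction \<open>(v, v)\<close>, since the remaining term is tangential to \<open>f\<close>.\<close>

definition second_fund :: "(real^3 \<Rightarrow> real^3) \<Rightarrow> real^3 \<Rightarrow> real^3 \<Rightarrow> real^3 \<Rightarrow> real" where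
  "second_fund f p v w =
     frechet_derivative (\<lambda>x. sphere_diff f x w) (at p) v \<bullet> sgn (normal_vec f p)"

text \<open>The eigenvalues of the shape operator; this set has one element at umbilic points and two
  elements elsewhere.\<close>

definition principal_curvatures :: "(real^3 \<Rightarrow> real^3) \<Rightarrow> real^3 \<Rightarrow> real set" where
  "principal_curvatures f p =
     {\<kappa>. \<exists>v\<in>sphere_tangent p. v \<noteq> 0 \<and>
          (\<forall>w\<in>sphere_tangent p. second_fund f p v w = \<kappa> * first_fund f p v w)}"

definition mean_curvature :: "(real^3 \<Rightarrow> real^3) \<Rightarrow> real^3 \<Rightarrow> real" where
  "mean_curvature f p = (Max (principal_curvatures f p) + Min (principal_curvatures f p)) / 2"

text \<open>The surface measure of the unit sphere is obtained as the cone measure: the area of \<open>A\<close> is three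
  times the volume of the cone \<open>{x \<in> ball 0 1. sgn x \<in> A}\<close>.\<close>

definition sphere_area :: "(real^3) measure" where
  "sphere_area = distr (density lborel (\<lambda>x. 3 * indicator (ball 0 1) x)) borel sgn"

definition induced_area :: "(real^3 \<Rightarrow> real^3) \<Rightarrow> (real^3) measure" where
  "induced_area f = density sphere_area (\<lambda>p. ennreal (norm (normal_vec f p)))"

definition willmore :: "(real^3 \<Rightarrow> real^3) \<Rightarrow> real" where
  "willmore f = (LINT p:sphere 0 1|induced_area f. (mean_curvature f p)\<^sup>2)"

subsection \<open>Round spheres\<close>

definition sphere_diffeo :: "(real^3 \<Rightarrow> real^3) \<Rightarrow> bool" where
  "sphere_diffeo \<psi> \<longleftrightarrow>
     (\<exists>\<psi>'. homeomorphism (sphere 0 1) (sphere 0 1) \<psi> \<psi>' \<and>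
           smooth_on (sphere 0 1) \<psi> \<and> smooth_on (sphere 0 1) \<psi>')"

definition round_sphere :: "(real^3 \<Rightarrow> real^3) \<Rightarrow> bool" where
  "round_sphere f \<longleftrightarrow>
     (\<exists>\<psi> a R. sphere_diffeo \<psi> \<and> R > 0 \<and> (\<forall>p\<in>sphere 0 1. f p = a + R *\<^sub>R \<psi> p))"

subsection \<open>Spheres of revolution\<close>

definition velocity :: "(real \<Rightarrow> real \<times> real) \<Rightarrow> real \<Rightarrow> real \<times> real" where
  "velocity c t = vector_derivative c (at t within {0..1})"

text \<open>As the curve is regular, it meets the axis \<open>r = 0\<close> perpendicularly iff \<open>h'\<close> vanishes there.\<close>

definition generating_curve :: "(real \<Rightarrow> real \<times> real) \<Rightarrow> bool" where
  "generating_curve c \<longleftrightarrow>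
     smooth_on {0..1} c \<and> (\<forall>t\<in>{0..1}. velocity c t \<noteq> 0) \<and>
     fst (c 0) = 0 \<and> fst (c 1) = 0 \<and> (\<forall>t\<in>{0<..<1}. fst (c t) > 0) \<and>
     snd (velocity c 0) = 0 \<and> snd (velocity c 1) = 0"

text \<open>A parametrization of the unit sphere by \<open>(t, \<phi>)\<close> in \<open>[0,1] \<times> \<real>\<close> of the type of
  (generalized) polar coordinates: the sides \<open>t = 0\<close> and \<open>t = 1\<close> are collapsed to one point each,
  \<open>\<phi>\<close> counts modulo \<open>2\<pi>\<close>, and there are no other identifications. It is regular away from the
  two poles.\<close>

definition polar_parametrization :: "(real \<times> real \<Rightarrow> real^3) \<Rightarrow> bool" where
  "polar_parametrization \<Phi> \<longleftrightarrow>
     continuous_on ({0..1} \<times> UNIV) \<Phi> \<and> \<Phi> ` ({0..1} \<times> UNIV) = sphere 0 1 \<and>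
     (\<forall>t\<in>{0..1}. \<forall>t'\<in>{0..1}. \<forall>\<phi> \<phi>'. \<Phi> (t, \<phi>) = \<Phi> (t', \<phi>') \<longleftrightarrow>
        t = t' \<and> (t = 0 \<or> t = 1 \<or> (\<exists>k::int. \<phi>' = \<phi> + 2 * pi * of_int k))) \<and>
     smooth_on ({0<..<1} \<times> UNIV) \<Phi> \<and>
     (\<forall>z\<in>{0<..<1} \<times> UNIV. inj (frechet_derivative \<Phi> (at z)))"

definition sphere_of_revolution :: "(real^3 \<Rightarrow> real^3) \<Rightarrow> (real \<Rightarrow> real \<times> real) \<Rightarrow> bool" where
  "sphere_of_revolution f c \<longleftrightarrow>
     sphere_immersion f \<and> generating_curve c \<and>
     (\<exists>\<Phi>. polar_parametrization \<Phi> \<and>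
        (\<forall>t\<in>{0..1}. \<forall>\<phi>. f (\<Phi> (t, \<phi>)) =
           vector [fst (c t) * cos \<phi>, fst (c t) * sin \<phi>, snd (c t)]))"

definition has_turning_number :: "(real \<Rightarrow> real \<times> real) \<Rightarrow> real \<Rightarrow> bool" where
  "has_turning_number c \<tau> \<longleftrightarrow>
     (\<exists>\<theta>. continuous_on {0..1} \<theta> \<and>
        (\<forall>t\<in>{0..1}. velocity c t = norm (velocity c t) *\<^sub>R (cos (\<theta> t), sin (\<theta> t))) \<and>
        \<tau> = (\<theta> 1 - \<theta> 0) / (2 * pi))"

end

theory Submission
  imports Defs
begin

text \<open>
  Let \<open>v\<close> be the speed of the generating curve \<open>c = (r, h)\<close> and \<open>\<theta>\<close> its tangent angle, so that
  \<open>r' = v cos \<theta>\<close> and \<open>h' = v sin \<theta>\<close>. The principal curvatures are, up to a common sign, \<open>\<theta>' / v\<close>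
  along the meridians and \<open>sin \<theta> / r\<close> along the parallels, and the area element is
  \<open>r v dt d\<phi>\<close>. Hence \<open>W(f) = (\<pi>/2) \<integral> J\<close> with \<open>J = (r \<theta>' + v sin \<theta>)\<^sup>2 / (r v)\<close>
  (\<open>willmore_revolution\<close>).

  Pointwise, \<open>J = 4 \<theta>' sin \<theta> + (r \<theta>' - v sin \<theta>)\<^sup>2 / (r v) \<ge> 4 \<theta>' sin \<theta>\<close>, and also \<open>J \<ge> 0\<close>. Using the
  first bound where \<open>sin \<theta> \<ge> 0\<close> and the second one elsewhere gives \<open>J \<ge> 4 max(sin \<theta>, 0) \<theta>'\<close>, which
  is the derivative of \<open>4 P(\<theta>)\<close> for an antiderivative \<open>P\<close> of \<open>max(sin, 0)\<close>. As \<open>c\<close> starts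
  perpendicularly to the axis, pointing away from it, \<open>\<theta>\<close> can be taken to run from \<open>0\<close> to
  \<open>2 \<pi> k + \<pi>\<close> with \<open>\<bar>\<tau>\<bar> = k + 1/2\<close>, after a reflection if \<open>\<tau> < 0\<close>. On the way it passes
  \<open>k + 1\<close> positive arches of the sine, and each of them contributes \<open>4 \<cdot> 2\<close> to the integral. This yields
  \<open>W(f) \<ge> 4 \<pi> (k + 1)\<close> (\<open>profile_energy\<close>).

  In the case of equality the bound in use is sharp at every point, that is \<open>r \<theta>' = v \<bar>sin \<theta>\<bar>\<close>. Then the positive
  part of the curvature \<open>sin \<theta> / r\<close> of the parallels is constant. It is positive where \<open>\<theta> = \<pi>/2\<close>,
  so \<open>sin \<theta> / r\<close> is a positive constant \<open>1/R\<close> throughout. Therefore \<open>k = 0\<close> and \<open>c\<close> is a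
  half circle of radius \<open>R\<close> centred on the axis (\<open>energy_equality_round\<close>). Then \<open>f\<close> is a
  smooth bijection onto a sphere of radius \<open>R\<close>, and as an immersion it has a smooth inverse
  (\<open>semicircle_profile_imp_round\<close>), so \<open>f\<close> is round.

  Two steps need care beyond this. The surface measure is defined through cones over subsets of the sphere, so the
  integral is transformed by the map \<open>(s, t, \<phi>) \<mapsto> s \<Phi>(t, \<phi>)\<close> of a box onto the unit ball up to
  two radii, where \<open>\<Phi>\<close> is the polar parametrization. And \<open>J\<close> must be continuous up to the ends of
  the profile, where \<open>sin \<theta> / r\<close> is a quotient \<open>0/0\<close> with a finite limit.
\<close>

section \<open>Calculus of maps with continuous iterated derivatives\<close>

lemma Ck_on_cong:
  assumes "open U" "Ck_on k U f" "\<And>x. x \<in> U \<Longrightarrow> f x = g x"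
  shows "Ck_on k U g"
  using assms(2,3)
proof (induction k arbitrary: f g)
  case 0
  then show ?case by (auto cong: continuous_on_cong)
next
  case (Suc k)
  have d: "f differentiable (at x)" if "x \<in> U" for x
    using Suc.prems(1) that by auto
  have dg: "g differentiable (at x)" if x: "x \<in> U" for x
  proof -
    obtain D where "(f has_derivative D) (at x)"
      using d[OF x] unfolding differentiable_def by blast
    then have "(g has_derivative D) (at x)"
      by (rule has_derivative_transform_within_open[OF _ assms(1) x]) (rule Suc.prems(2))
    then show ?thesis by (rule differentiableI)
  qed
  have eq: "frechet_derivative f (at x) = frechet_derivative g (at x)" if "x \<in> U" for x
    using frechet_derivative_transform_within_open[OF d assms(1)] that Suc.prems(2) by blast
  have "Ck_on k U (\<lambda>x. frechet_derivative g (at x) v)" for v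
  proof (rule Suc.IH)
    show "Ck_on k U (\<lambda>x. frechet_derivative f (at x) v)" using Suc.prems(1) by simp
  qed (simp add: eq)
  then show ?case using dg by simp
qed

text \<open>Proofs of regularity below go by induction on the order: exhibit the derivative and show that its
  directional values are one order less regular.\<close>
lemma Ck_on_SucI:
  assumes "open U" "\<And>x. x \<in> U \<Longrightarrow> (f has_derivative D x) (at x)"
    "\<And>v. Ck_on k U (\<lambda>x. D x v)"
  shows "Ck_on (Suc k) U f"
proof -
  have "D x = frechet_derivative f (at x)" if "x \<in> U" for x
    using frechet_derivative_at[OF assms(2)[OF that]] .
  then have "Ck_on k U (\<lambda>x. frechet_derivative f (at x) v)" for v
    by (intro Ck_on_cong[OF assms(1) assms(3)[of v]]) simp
  then show ?thesis
    using assms(2) by (auto intro: differentiableI)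
qed

lemma Ck_on_Suc_has_derivative:
  assumes "Ck_on (Suc k) U f" "x \<in> U"
  shows "(f has_derivative frechet_derivative f (at x)) (at x)"
  using assms by (simp add: frechet_derivative_works)

lemma Ck_on_Suc_derivative:
  assumes "Ck_on (Suc k) U f"
  shows "Ck_on k U (\<lambda>x. frechet_derivative f (at x) v)"
  using assms by simp

lemma Ck_on_SucD: "Ck_on (Suc k) U f \<Longrightarrow> Ck_on k U f"
proof (induction k arbitrary: f)
  case 0
  then show ?case
    by (auto intro!: continuous_at_imp_continuous_on differentiable_imp_continuous_within)
next
  case (Suc k)
  then show ?case by simp
qed

lemma Ck_on_subset: "Ck_on k U f \<Longrightarrow> V \<subseteq> U \<Longrightarrow> Ck_on k V f"
  by (induction k arbitrary: f) (auto intro: continuous_on_subset)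

lemma Ck_on_const: "open U \<Longrightarrow> Ck_on k U (\<lambda>x. c)"
proof (induction k arbitrary: c)
  case (Suc k)
  then show ?case by (intro Ck_on_SucI[where D = "\<lambda>x v. 0"]) auto
qed auto

lemma Ck_on_bounded_linear:
  assumes "open U" "bounded_linear L" "Ck_on k U f"
  shows "Ck_on k U (\<lambda>x. L (f x))"
  using assms(3)
proof (induction k arbitrary: f)
  case 0
  then show ?case
    using bounded_linear.continuous_on[OF assms(2)] by simp
next
  case (Suc k)
  show ?case
  proof (rule Ck_on_SucI[OF assms(1)])
    show "((\<lambda>x. L (f x)) has_derivative (\<lambda>v. L (frechet_derivative f (at x) v))) (at x)"
      if "x \<in> U" for x
      by (rule bounded_linear.has_derivative[OF assms(2) Ck_on_Suc_has_derivative[OF Suc.prems that]])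
    show "Ck_on k U (\<lambda>x. L (frechet_derivative f (at x) v))" for v
      by (rule Suc.IH[OF Ck_on_Suc_derivative[OF Suc.prems]])
  qed
qed

lemma Ck_on_ident:
  assumes "open U"
  shows "Ck_on k U (\<lambda>x. x)"
  by (cases k) (auto intro!: Ck_on_SucI[OF assms, where D = "\<lambda>x v. v"] Ck_on_const assms)

lemma Ck_on_add:
  assumes "open U" "Ck_on k U f" "Ck_on k U g"
  shows "Ck_on k U (\<lambda>x. f x + g x)"
  using assms(2,3)
proof (induction k arbitrary: f g)
  case 0
  then show ?case by (auto intro: continuous_intros)
next
  case (Suc k)
  show ?case
  proof (rule Ck_on_SucI[OF assms(1)])
    show "((\<lambda>x. f x + g x) has_derivative
        (\<lambda>v. frechet_derivative f (at x) v + frechet_derivative g (at x) v)) (at x)"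
      if "x \<in> U" for x
      using that Suc.prems by (intro has_derivative_add Ck_on_Suc_has_derivative)
    show "Ck_on k U (\<lambda>x. frechet_derivative f (at x) v + frechet_derivative g (at x) v)" for v
      using Suc.prems by (intro Suc.IH Ck_on_Suc_derivative)
  qed
qed

lemma Ck_on_sum:
  assumes "open U" "\<And>i. i \<in> I \<Longrightarrow> Ck_on k U (f i)"
  shows "Ck_on k U (\<lambda>x. \<Sum>i\<in>I. f i x)"
  using assms(2)
  by (induction I rule: infinite_finite_induct) (auto intro!: Ck_on_const Ck_on_add assms(1))

lemma Ck_on_bilinear:
  assumes "open U" "bounded_bilinear B" "Ck_on k U f" "Ck_on k U g"
  shows "Ck_on k U (\<lambda>x. B (f x) (g x))"
  using assms(3,4)
proof (induction k arbitrary: f g)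
  case 0
  then show ?case using bounded_bilinear.continuous_on[OF assms(2)] by simp
next
  case (Suc k)
  show ?case
  proof (rule Ck_on_SucI[OF assms(1)])
    show "((\<lambda>x. B (f x) (g x)) has_derivative
        (\<lambda>v. B (f x) (frechet_derivative g (at x) v) + B (frechet_derivative f (at x) v) (g x))) (at x)"
      if "x \<in> U" for x
      using that Suc.prems
      by (intro bounded_bilinear.FDERIV[OF assms(2)] Ck_on_Suc_has_derivative)
    show "Ck_on k U (\<lambda>x. B (f x) (frechet_derivative g (at x) v)
        + B (frechet_derivative f (at x) v) (g x))" for v
      by (intro Ck_on_add assms(1) Suc.IH Ck_on_Suc_derivative[OF Suc.prems(1)]
          Ck_on_Suc_derivative[OF Suc.prems(2)] Ck_on_SucD[OF Suc.prems(1)] Ck_on_SucD[OF Suc.prems(2)])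
  qed
qed

lemmas Ck_on_scaleR = Ck_on_bilinear[OF _ bounded_bilinear_scaleR]
lemmas Ck_on_mult = Ck_on_bilinear[OF _ bounded_bilinear_mult]
lemmas Ck_on_inner = Ck_on_bilinear[OF _ bounded_bilinear_inner]

lemma bounded_bilinear_cross3: "bounded_bilinear cross3"
  using bilinear_conv_bounded_bilinear bilinear_cross by blast

lemmas Ck_on_cross3 = Ck_on_bilinear[OF _ bounded_bilinear_cross3]

lemma linear_eq_sum_Basis:
  fixes L :: "'a::euclidean_space \<Rightarrow> 'b::real_vector"
  assumes "linear L"
  shows "L v = (\<Sum>b\<in>Basis. (v \<bullet> b) *\<^sub>R L b)"
proof -
  have "L v = L (\<Sum>b\<in>Basis. (v \<bullet> b) *\<^sub>R b)" by (simp add: euclidean_representation)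
  also have "\<dots> = (\<Sum>b\<in>Basis. (v \<bullet> b) *\<^sub>R L b)"
    using assms by (simp add: linear_sum linear_scale)
  finally show ?thesis .
qed

text \<open>The chain rule alone gives a derivative of \<open>f\<close> in a direction that varies with the point. Expanding the
  direction in the basis turns this into sums of products of functions to which the induction
  hypothesis applies.\<close>
lemma Ck_on_compose:
  fixes g :: "'a::real_normed_vector \<Rightarrow> 'b::euclidean_space"
    and f :: "'b \<Rightarrow> 'c::real_normed_vector"
  assumes U: "open U" and "Ck_on k U g" "Ck_on k V f" "g ` U \<subseteq> V"
  shows "Ck_on k U (\<lambda>x. f (g x))"
  using assms(2-4)
proof (induction k arbitrary: f)
  case 0
  then show ?case
    using continuous_on_compose2[of V f U g] by simp
next
  case (Suc k)
  let ?Df = "\<lambda>y. frechet_derivative f (at y)" and ?Dg = "\<lambda>x. frechet_derivative g (at x)"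
  have f: "(f has_derivative ?Df (g x)) (at (g x))" if "x \<in> U" for x
    using that Suc.prems by (intro Ck_on_Suc_has_derivative[OF Suc.prems(2)]) auto
  show ?case
  proof (rule Ck_on_SucI[OF U])
    show "((\<lambda>x. f (g x)) has_derivative
        (\<lambda>v. \<Sum>b\<in>Basis. (?Dg x v \<bullet> b) *\<^sub>R ?Df (g x) b)) (at x)"
      if "x \<in> U" for x
    proof -
      have "((\<lambda>x. f (g x)) has_derivative (\<lambda>v. ?Df (g x) (?Dg x v))) (at x)"
        using has_derivative_compose[OF Ck_on_Suc_has_derivative[OF Suc.prems(1) that] f[OF that]] .
      moreover have "linear (?Df (g x))"
        using f[OF that] by (simp add: has_derivative_linear)
      ultimately show ?thesis
        by (simp add: linear_eq_sum_Basis[where L = "?Df (g x)"])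
    qed
    show "Ck_on k U (\<lambda>x. \<Sum>b\<in>Basis. (?Dg x v \<bullet> b) *\<^sub>R ?Df (g x) b)" for v
      by (intro Ck_on_sum Ck_on_scaleR Ck_on_inner Ck_on_const Suc.IH U Suc.prems(3)
          Ck_on_Suc_derivative[OF Suc.prems(1)] Ck_on_Suc_derivative[OF Suc.prems(2)]
          Ck_on_SucD[OF Suc.prems(1)])
  qed
qed

lemma Ck_on_inverse: "Ck_on k {0<..} (inverse :: real \<Rightarrow> real)"
proof (induction k)
  case 0
  then show ?case by (auto intro!: continuous_intros)
next
  case (Suc k)
  show ?case
  proof (rule Ck_on_SucI)
    show "(inverse has_derivative (\<lambda>v. - (inverse x * v * inverse x))) (at x)"
      if "x \<in> {0<..}" for x :: real
      using that by (auto intro!: has_derivative_inverse')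
    have "Ck_on k {0<..} (\<lambda>x. - v * (inverse x * inverse x))" for v :: real
      by (intro Ck_on_mult Ck_on_const Suc) auto
    then show "Ck_on k {0<..} (\<lambda>x. - (inverse x * v * inverse x))" for v :: real
      by (rule Ck_on_cong[rotated]) auto
  qed auto
qed

lemma Ck_on_sqrt: "Ck_on k {0<..} (sqrt :: real \<Rightarrow> real)"
proof (induction k)
  case 0
  then show ?case by (auto intro!: continuous_intros)
next
  case (Suc k)
  show ?case
  proof (rule Ck_on_SucI)
    show "(sqrt has_derivative (\<lambda>v. v / 2 * inverse (sqrt x))) (at x)"
      if "x \<in> {0<..}" for x :: real
    proof -
      have "(sqrt has_derivative (*) (inverse (sqrt x) / 2)) (at x)"
        using that DERIV_real_sqrt[of x] by (simp add: has_field_derivative_def)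
      then show ?thesis by (rule has_derivative_eq_rhs) (simp add: fun_eq_iff)
    qed
    have "Ck_on k {0<..} (\<lambda>x. inverse (sqrt x))"
      by (intro Ck_on_compose[OF _ Suc Ck_on_inverse]) auto
    then show "Ck_on k {0<..} (\<lambda>x. v / 2 * inverse (sqrt x))" for v :: real
      by (intro Ck_on_mult Ck_on_const) auto
  qed auto
qed

text \<open>Regularity of \<open>inverse\<close> is available on the positive reals; negative values are reached by
  \<open>1/y = y \<cdot> 1/y\<^sup>2\<close>.\<close>
lemma Ck_on_real_inverse:
  fixes f :: "'a::real_normed_vector \<Rightarrow> real"
  assumes "open U" "Ck_on k U f" "\<And>x. x \<in> U \<Longrightarrow> f x \<noteq> 0"
  shows "Ck_on k U (\<lambda>x. inverse (f x))"
proof -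
  have "Ck_on k U (\<lambda>x. f x * inverse (f x * f x))"
  proof (intro Ck_on_mult assms(1,2) Ck_on_compose[where g = "\<lambda>x. f x * f x", OF _ _ Ck_on_inverse])
    show "(\<lambda>x. f x * f x) ` U \<subseteq> {0<..}"
    proof
      fix y assume "y \<in> (\<lambda>x. f x * f x) ` U"
      then obtain x where "x \<in> U" "y = f x * f x" by auto
      then show "y \<in> {0<..}" using assms(3)[of x] by (simp add: zero_less_mult_iff linorder_neq_iff disj_commute)
    qed
  qed
  then show ?thesis
    by (rule Ck_on_cong[OF assms(1)]) (use assms(3) in \<open>simp add: field_simps\<close>)
qed

lemma Ck_on_norm: "Ck_on k (- {0}) (norm :: 'a::euclidean_space \<Rightarrow> real)"
  unfolding norm_eq_sqrt_inner
  by (intro Ck_on_compose[OF _ _ Ck_on_sqrt] Ck_on_inner Ck_on_ident) auto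

lemma Ck_on_sgn: "Ck_on k (- {0}) (sgn :: 'a::euclidean_space \<Rightarrow> 'a)"
  unfolding sgn_div_norm
  by (intro Ck_on_scaleR Ck_on_real_inverse Ck_on_norm Ck_on_ident) auto

lemma linear_real3_expansion:
  fixes A :: "real^3 \<Rightarrow> 'b::real_vector"
  assumes "linear A"
  shows "A x = (x$1) *\<^sub>R A (axis 1 1) + (x$2) *\<^sub>R A (axis 2 1) + (x$3) *\<^sub>R A (axis 3 1)"
proof -
  have "x = (x$1) *\<^sub>R axis 1 1 + (x$2) *\<^sub>R axis 2 1 + (x$3) *\<^sub>R axis 3 1"
    by (simp add: vec_eq_iff forall_3 axis_def)
  then have "A x = A ((x$1) *\<^sub>R axis 1 1 + (x$2) *\<^sub>R axis 2 1 + (x$3) *\<^sub>R axis 3 1)"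
    by simp
  then show ?thesis
    by (simp only: linear_add[OF assms] linear_scale[OF assms])
qed

text \<open>Cramer's rule with the cofactors written as cross products. What matters is that the inverse is an
  explicit rational expression in the columns of \<open>A\<close>, so that it depends smoothly on \<open>A\<close>.\<close>
lemma linear_inverse_cross3:
  fixes A :: "real^3 \<Rightarrow> real^3"
  assumes "linear A"
  defines "a \<equiv> A (axis 1 1)" and "b \<equiv> A (axis 2 1)" and "c \<equiv> A (axis 3 1)"
  defines "B \<equiv> \<lambda>v. inverse (a \<bullet> cross3 b c) *\<^sub>R
     ((v \<bullet> cross3 b c) *\<^sub>R axis 1 1 + (v \<bullet> cross3 c a) *\<^sub>R axis 2 1 + (v \<bullet> cross3 a b) *\<^sub>R axis 3 1)"
  assumes "inj A"
  shows "a \<bullet> cross3 b c \<noteq> 0" "A (B v) = v" "B (A v) = v"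
proof -
  have A: "A x = (x$1) *\<^sub>R a + (x$2) *\<^sub>R b + (x$3) *\<^sub>R c" for x
    unfolding a_def b_def c_def by (rule linear_real3_expansion[OF assms(1)])
  have id: "(v \<bullet> cross3 b c) *\<^sub>R a + (v \<bullet> cross3 c a) *\<^sub>R b + (v \<bullet> cross3 a b) *\<^sub>R c
      = (a \<bullet> cross3 b c) *\<^sub>R v" for v
    unfolding vec_eq_iff forall_3 inner_vec_def sum_3 cross3_def
    by (simp, intro conjI; algebra)
  show nz: "a \<bullet> cross3 b c \<noteq> 0"
  proof
    assume "a \<bullet> cross3 b c = 0"
    \<comment> \<open>by the cofactor identity \<open>id\<close>, these coefficients give a vector in the kernel of \<open>A\<close>\<close>
    let ?w = "vector [cross3 b c \<bullet> cross3 b c, cross3 b c \<bullet> cross3 c a, cross3 b c \<bullet> cross3 a b] :: real^3"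
    have "A ?w = 0"
      using id[of "cross3 b c"] \<open>a \<bullet> cross3 b c = 0\<close> by (simp add: A)
    then have "?w = 0" using linear_injective_0[OF assms(1)] \<open>inj A\<close> by blast
    then have "cross3 b c = 0"
      by (metis inner_eq_zero_iff vector_3(1) zero_index)
    then have "collinear {0, b, c}" by (simp add: cross_eq_0)
    then consider "b = 0" | k where "c = k *\<^sub>R b"
      unfolding collinear_lemma by (metis scaleR_zero_left)
    then show False
    proof cases
      case 1
      then have "axis 2 (1::real) = (0::real^3)"
        using linear_injective_0[OF assms(1)] \<open>inj A\<close> unfolding b_def by blast
      then show False by (simp add: axis_eq_0_iff)
    next
      case 2
      then have "A (axis 3 1) = A (k *\<^sub>R axis 2 1)"
        using assms(1) by (simp add: b_def c_def linear_scale)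
      then have "(axis 3 1 :: real^3) = k *\<^sub>R axis 2 1" using \<open>inj A\<close> by (meson injD)
      then have "(axis 3 1 :: real^3) $ 3 = (k *\<^sub>R axis 2 1 :: real^3) $ 3" by (rule arg_cong)
      then show False by (simp add: axis_def)
    qed
  qed
  have B: "B v = vector [inverse (a \<bullet> cross3 b c) * (v \<bullet> cross3 b c),
      inverse (a \<bullet> cross3 b c) * (v \<bullet> cross3 c a), inverse (a \<bullet> cross3 b c) * (v \<bullet> cross3 a b)]" for v
    by (simp add: B_def vec_eq_iff forall_3 axis_def)
  show AB: "A (B v) = v" for v
  proof -
    have "A (B v) = inverse (a \<bullet> cross3 b c) *\<^sub>R
      ((v \<bullet> cross3 b c) *\<^sub>R a + (v \<bullet> cross3 c a) *\<^sub>R b + (v \<bullet> cross3 a b) *\<^sub>R c)"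
      by (simp add: A B scaleR_add_right)
    then show ?thesis using nz by (simp add: id)
  qed
  show "B (A v) = v"
    using AB[of "A v"] \<open>inj A\<close> by (meson injD)
qed

text \<open>The derivative of the inverse at \<open>y\<close> is the inverse matrix of the derivative of \<open>f\<close> at \<open>g y\<close>, which is of
  class \<open>C\<^sup>k\<close> as soon as \<open>g\<close> is. This gains one order at each step, starting from continuity.\<close>
lemma Ck_on_inverse_function:
  fixes f g :: "real^3 \<Rightarrow> real^3"
  assumes U: "open U" and V: "open V" and f: "\<And>k. Ck_on k U f"
    and inj: "\<And>x. x \<in> U \<Longrightarrow> inj (frechet_derivative f (at x))"
    and g: "continuous_on V g" "g ` V \<subseteq> U" and fg: "\<And>y. y \<in> V \<Longrightarrow> f (g y) = y"
  shows "Ck_on k V g"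
proof (induction k)
  case 0
  then show ?case using g by simp
next
  case (Suc k)
  let ?D = "\<lambda>y. frechet_derivative f (at (g y))"
  let ?a = "\<lambda>y. ?D y (axis 1 1)" and ?b = "\<lambda>y. ?D y (axis 2 1)" and ?c = "\<lambda>y. ?D y (axis 3 1)"
  let ?d = "\<lambda>y. ?a y \<bullet> cross3 (?b y) (?c y)"
  let ?B = "\<lambda>y v. inverse (?d y) *\<^sub>R
     ((v \<bullet> cross3 (?b y) (?c y)) *\<^sub>R axis 1 1 + (v \<bullet> cross3 (?c y) (?a y)) *\<^sub>R axis 2 1
        + (v \<bullet> cross3 (?a y) (?b y)) *\<^sub>R axis 3 1)"
  have D: "(f has_derivative ?D y) (at (g y))" if "y \<in> V" for y
    using that g(2) by (intro Ck_on_Suc_has_derivative[OF f]) auto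
  have lin: "linear (?D y)" and injD: "inj (?D y)" if "y \<in> V" for y
    using D[OF that] that g(2) inj by (auto simp: has_derivative_linear)
  note inv = linear_inverse_cross3[OF lin injD]
  have col: "Ck_on k V (\<lambda>y. ?D y w)" for w
    by (rule Ck_on_compose[OF V Suc Ck_on_Suc_derivative[OF f] g(2)])
  show ?case
  proof (rule Ck_on_SucI[OF V])
    fix y assume y: "y \<in> V"
    have "linear (?B y)"
      by (intro linearI) (auto simp: inner_add_left algebra_simps)
    then have "bounded_linear (?B y)" by (rule linear_conv_bounded_linear[THEN iffD1])
    moreover have "?B y \<circ> ?D y = id"
    proof
      show "(?B y \<circ> ?D y) v = id v" for v
        unfolding o_apply id_apply by (rule inv(3)[OF y y])
    qed
    moreover have "continuous (at y) g"
      using g(1) y V by (simp only: continuous_on_eq_continuous_at)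
    ultimately show "(g has_derivative ?B y) (at y)"
      by (rule has_derivative_inverse_basic[OF D[OF y] _ _ _ V y fg])
  next
    show "Ck_on k V (\<lambda>y. ?B y v)" for v
      by (intro Ck_on_scaleR Ck_on_real_inverse Ck_on_add Ck_on_inner Ck_on_cross3 Ck_on_const
          col inv(1) V)
  qed
qed

section \<open>Curvature of maps of the sphere\<close>

lemma sphere_extension_Ck_on:
  assumes "smooth_on (sphere 0 1) (f :: real^3 \<Rightarrow> real^3)"
  shows "Ck_on k (- {0}) (\<lambda>x. f (sgn x))"
proof -
  obtain U g where U: "open U" "sphere 0 1 \<subseteq> U" and g: "\<And>k. Ck_on k U g"
    and eq: "\<And>x. x \<in> sphere 0 1 \<Longrightarrow> g x = f x"
    using assms unfolding smooth_on_def by blast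
  have sgn: "sgn x \<in> sphere 0 1" if "x \<noteq> 0" for x :: "real^3"
    using that by (simp add: norm_sgn)
  have "Ck_on k (- {0}) (\<lambda>x. g (sgn x))"
    by (rule Ck_on_compose[OF _ Ck_on_sgn g]) (use sgn U(2) in blast)+
  then show ?thesis
    by (rule Ck_on_cong[rotated]) (use sgn eq in auto)
qed

lemma open_nonzero: "open (- {0 :: 'a :: real_normed_vector})"
  by (simp add: open_Compl)

text \<open>The cofactor matrix of \<open>A\<close> maps \<open>cross3 a b\<close> to \<open>cross3 (A a) (A b)\<close>; here it is applied
  coordinatewise.\<close>
lemma linear_cross3_cofactor:
  fixes A :: "real^3 \<Rightarrow> real^3"
  assumes "linear A"
  shows "cross3 (A a) (A b) = (cross3 a b $ 1) *\<^sub>R cross3 (A (axis 2 1)) (A (axis 3 1))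
     + (cross3 a b $ 2) *\<^sub>R cross3 (A (axis 3 1)) (A (axis 1 1))
     + (cross3 a b $ 3) *\<^sub>R cross3 (A (axis 1 1)) (A (axis 2 1))"
proof -
  note A = linear_real3_expansion[OF assms]
  show ?thesis
    unfolding A[of a] A[of b] vec_eq_iff forall_3 cross3_def
    by (simp, intro conjI; algebra)
qed

lemma cross3_orthogonal_unit:
  fixes p a b :: "real^3"
  assumes "norm p = 1" "a \<bullet> p = 0" "b \<bullet> p = 0"
  shows "cross3 a b = (p \<bullet> cross3 a b) *\<^sub>R p"
proof -
  have "cross3 p (cross3 a b) = (p \<bullet> b) *\<^sub>R a - (p \<bullet> a) *\<^sub>R b"
    unfolding vec_eq_iff forall_3 cross3_def inner_vec_def sum_3
    by (simp, intro conjI; algebra)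
  then have 0: "cross3 p (cross3 a b) = 0" using assms by (simp add: inner_commute)
  have "cross3 (cross3 p (cross3 a b)) p = (p \<bullet> p) *\<^sub>R cross3 a b - (p \<bullet> cross3 a b) *\<^sub>R p"
    unfolding vec_eq_iff forall_3 cross3_def inner_vec_def sum_3
    by (simp, intro conjI; algebra)
  moreover have "p \<bullet> p = 1" using assms(1) by (simp add: norm_eq_1)
  ultimately show ?thesis by (simp add: 0)
qed

text \<open>All derivatives are those of the radially constant extension \<open>\<lambda>x. f (sgn x)\<close>, which is smooth away
  from the origin.\<close>
locale smooth_sphere_map =
  fixes f :: "real^3 \<Rightarrow> real^3"
  assumes smooth: "smooth_on (sphere 0 1) f"
begin

lemma has_derivative:
  assumes "p \<noteq> 0"
  shows "((\<lambda>x. f (sgn x)) has_derivative sphere_diff f p) (at p)"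
proof -
  have "((\<lambda>x. f (sgn x)) has_derivative frechet_derivative (\<lambda>x. f (sgn x)) (at p)) (at p)"
    using assms by (intro Ck_on_Suc_has_derivative[OF sphere_extension_Ck_on[OF smooth]]) auto
  moreover have "frechet_derivative (\<lambda>x. f (sgn x)) (at p) = sphere_diff f p"
    by (simp add: fun_eq_iff sphere_diff_def)
  ultimately show ?thesis by simp
qed

lemma linear: "p \<noteq> 0 \<Longrightarrow> linear (sphere_diff f p)"
  using has_derivative has_derivative_linear by blast

lemma Ck_on_sphere_diff: "Ck_on k (- {0}) (\<lambda>x. sphere_diff f x w)"
  unfolding sphere_diff_def
  by (rule Ck_on_Suc_derivative[OF sphere_extension_Ck_on[OF smooth]])

lemma has_derivative2:
  assumes "p \<noteq> 0"
  shows "((\<lambda>x. sphere_diff f x w) has_derivative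
    frechet_derivative (\<lambda>x. sphere_diff f x w) (at p)) (at p)"
  using assms by (intro Ck_on_Suc_has_derivative[OF Ck_on_sphere_diff]) auto

lemma curve_has_vector_derivative:
  assumes "(\<gamma> has_vector_derivative \<gamma>') (at t)" "\<gamma> t \<noteq> 0"
  shows "((\<lambda>s. f (sgn (\<gamma> s))) has_vector_derivative sphere_diff f (\<gamma> t) \<gamma>') (at t)"
  using has_derivative_compose[OF assms(1)[unfolded has_vector_derivative_def],
      where g = "\<lambda>x. f (sgn x)", OF has_derivative[OF assms(2)]]
    linear_scale[OF linear[OF assms(2)]]
  by (simp add: has_vector_derivative_def)

lemma radial: 
  assumes "p \<noteq> 0"
  shows "sphere_diff f p p = 0"
proof -
  have "((\<lambda>s. s *\<^sub>R p) has_vector_derivative p) (at 1)"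
    by (auto intro!: derivative_eq_intros)
  from curve_has_vector_derivative[OF this] assms
  have "((\<lambda>s. f (sgn (s *\<^sub>R p))) has_vector_derivative sphere_diff f p p) (at 1)"
    by simp
  then have "((\<lambda>s::real. f (sgn p)) has_vector_derivative sphere_diff f p p) (at 1)"
    by (rule has_vector_derivative_transform_within_open[of _ _ _ "{0<..}"])
       (auto simp: sgn_scaleR)
  then show ?thesis
    using vector_derivative_unique_at[OF _ has_vector_derivative_const] by blast
qed

text \<open>A formula for \<open>normal_vec\<close> that involves no choice of a tangent frame. It shows that the normal vector
  depends continuously on the point, also off the sphere.\<close>
definition cofactor :: "real^3 \<Rightarrow> real^3" where
  "cofactor p = (p $ 1) *\<^sub>R cross3 (sphere_diff f p (axis 2 1)) (sphere_diff f p (axis 3 1))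
     + (p $ 2) *\<^sub>R cross3 (sphere_diff f p (axis 3 1)) (sphere_diff f p (axis 1 1))
     + (p $ 3) *\<^sub>R cross3 (sphere_diff f p (axis 1 1)) (sphere_diff f p (axis 2 1))"

lemma normal_vec_cofactor:
  assumes "p \<noteq> 0"
  shows "normal_vec f p = cofactor p"
proof -
  obtain y :: "real^3" where y: "y \<noteq> 0" "orthogonal p y"
    using orthogonal_to_vector_exists[of p] by auto
  then have "norm (sgn y) = 1 \<and> sgn y \<in> sphere_tangent p"
    by (simp add: norm_sgn sphere_tangent_def sgn_div_norm orthogonal_def inner_commute)
  then have "\<exists>u. norm u = 1 \<and> u \<in> sphere_tangent p" by blast
  define u where "u = (SOME u. norm u = 1 \<and> u \<in> sphere_tangent p)"
  have "norm u = 1 \<and> u \<in> sphere_tangent p"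
    unfolding u_def by (rule someI_ex) fact
  then have u: "u \<bullet> u = 1" "u \<bullet> p = 0" by (auto simp: sphere_tangent_def norm_eq_1)
  have "cross3 u (cross3 p u) = (u \<bullet> u) *\<^sub>R p - (u \<bullet> p) *\<^sub>R u"
    unfolding vec_eq_iff forall_3 cross3_def inner_vec_def sum_3
    by (simp, intro conjI; algebra)
  then have "cross3 u (cross3 p u) = p" using u by simp
  then show ?thesis
    unfolding normal_vec_def Let_def u_def[symmetric] cofactor_def
    by (subst linear_cross3_cofactor[OF linear[OF assms]]) simp
qed

lemma Ck_on_cofactor: "Ck_on k (- {0}) cofactor"
proof -
  have "Ck_on k (- {0}) (\<lambda>x::real^3. x $ i)" for i
    by (rule Ck_on_bounded_linear[OF _ bounded_linear_vec_nth Ck_on_ident]) auto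
  then show ?thesis
    unfolding cofactor_def
    by (intro Ck_on_add Ck_on_scaleR Ck_on_cross3 Ck_on_sphere_diff) auto
qed

lemma continuous_on_normal_vec: "continuous_on (- {0}) (normal_vec f)"
  by (rule continuous_on_eq[OF Ck_on_cofactor[of 0, unfolded Ck_on.simps]])
     (simp add: normal_vec_cofactor)

lemma cross3_sphere_diff:
  assumes "norm p = 1" "a \<bullet> p = 0" "b \<bullet> p = 0"
  shows "cross3 (sphere_diff f p a) (sphere_diff f p b) = (p \<bullet> cross3 a b) *\<^sub>R normal_vec f p"
proof -
  have p: "p \<noteq> 0" using assms(1) by auto
  have "cross3 a b $ i = (p \<bullet> cross3 a b) * p $ i" for i
    using arg_cong[OF cross3_orthogonal_unit[OF assms], of "\<lambda>x. x $ i"] by simp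
  then show ?thesis
    unfolding normal_vec_cofactor[OF p] cofactor_def linear_cross3_cofactor[OF linear[OF p], of a b]
    by (simp add: scaleR_add_right)
qed

text \<open>The inner product of an image vector with the cofactor expression is a multiple of the determinant
  of the derivative, which vanishes because the radial direction is in the kernel.\<close>
lemma sphere_diff_normal:
  assumes "p \<noteq> 0"
  shows "sphere_diff f p v \<bullet> normal_vec f p = 0"
proof -
  let ?A = "sphere_diff f p"
  let ?d = "?A (axis 1 1) \<bullet> cross3 (?A (axis 2 1)) (?A (axis 3 1))"
  note A = linear_real3_expansion[OF linear[OF assms]]
  have id: "?A v \<bullet> normal_vec f p = ?d * (v \<bullet> p)" for v
    unfolding normal_vec_cofactor[OF assms] cofactor_def A[of v]
    unfolding inner_vec_def sum_3 cross3_def by (simp, algebra)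
  have "?d * (p \<bullet> p) = 0" using id[of p] radial[OF assms] by simp
  then show ?thesis using assms by (simp add: id)
qed

text \<open>Product rule for a vector field \<open>w\<close> carried along a curve: the first summand differentiates the base
  point, the second one the vector.\<close>
lemma curve_has_vector_derivative2:
  assumes \<gamma>: "(\<gamma> has_vector_derivative \<gamma>') (at t)" "\<gamma> t \<noteq> 0"
    and w: "(w has_vector_derivative w') (at t)"
  shows "((\<lambda>s. sphere_diff f (\<gamma> s) (w s)) has_vector_derivative
      frechet_derivative (\<lambda>x. sphere_diff f x (w t)) (at (\<gamma> t)) \<gamma>' + sphere_diff f (\<gamma> t) w') (at t)"
proof -
  let ?D2 = "\<lambda>b. frechet_derivative (\<lambda>x. sphere_diff f x b) (at (\<gamma> t))"
  have expand: "sphere_diff f x v = (\<Sum>b\<in>Basis. (v \<bullet> b) *\<^sub>R sphere_diff f x b)" if "x \<noteq> 0" for x v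
    by (rule linear_eq_sum_Basis[OF linear[OF that]])
  have "((\<lambda>x. \<Sum>b\<in>Basis. (w t \<bullet> b) *\<^sub>R sphere_diff f x b) has_derivative
      (\<lambda>v. \<Sum>b\<in>Basis. (w t \<bullet> b) *\<^sub>R ?D2 b v)) (at (\<gamma> t))"
    by (intro has_derivative_sum has_derivative_scaleR_right has_derivative2 \<gamma>)
  then have "((\<lambda>x. sphere_diff f x (w t)) has_derivative
      (\<lambda>v. \<Sum>b\<in>Basis. (w t \<bullet> b) *\<^sub>R ?D2 b v)) (at (\<gamma> t))"
    by (rule has_derivative_transform_within_open[OF _ open_nonzero]) (use \<gamma>(2) expand in auto)
  then have D2: "?D2 (w t) = (\<lambda>v. \<Sum>b\<in>Basis. (w t \<bullet> b) *\<^sub>R ?D2 b v)"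
    by (rule frechet_derivative_at[symmetric])
  have 1: "((\<lambda>s. sphere_diff f (\<gamma> s) b) has_vector_derivative ?D2 b \<gamma>') (at t)" for b
    using has_derivative_compose[OF \<gamma>(1)[unfolded has_vector_derivative_def],
        where g = "\<lambda>x. sphere_diff f x b", OF has_derivative2[OF \<gamma>(2)]]
      linear_scale[OF has_derivative_linear[OF has_derivative2[OF \<gamma>(2)]]]
    by (simp add: has_vector_derivative_def)
  have 2: "((\<lambda>s. w s \<bullet> b) has_real_derivative w' \<bullet> b) (at t)" for b
    using bounded_linear.has_vector_derivative[OF bounded_linear_inner_left w, of b]
    by (simp add: has_real_derivative_iff_has_vector_derivative)
  have "((\<lambda>s. \<Sum>b\<in>Basis. (w s \<bullet> b) *\<^sub>R sphere_diff f (\<gamma> s) b) has_vector_derivative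
      (\<Sum>b\<in>Basis. (w t \<bullet> b) *\<^sub>R ?D2 b \<gamma>' + (w' \<bullet> b) *\<^sub>R sphere_diff f (\<gamma> t) b)) (at t)"
    by (intro has_vector_derivative_sum has_vector_derivative_scaleR 1 2)
  moreover have "(\<Sum>b\<in>Basis. (w t \<bullet> b) *\<^sub>R ?D2 b \<gamma>' + (w' \<bullet> b) *\<^sub>R sphere_diff f (\<gamma> t) b)
      = ?D2 (w t) \<gamma>' + sphere_diff f (\<gamma> t) w'"
    by (simp add: sum.distrib D2 expand[OF \<gamma>(2), of w'])
  ultimately have "((\<lambda>s. \<Sum>b\<in>Basis. (w s \<bullet> b) *\<^sub>R sphere_diff f (\<gamma> s) b) has_vector_derivative
      ?D2 (w t) \<gamma>' + sphere_diff f (\<gamma> t) w') (at t)" by simp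
  moreover have "eventually (\<lambda>s. \<gamma> s \<noteq> 0) (nhds t)"
    using has_vector_derivative_continuous[OF \<gamma>(1)] \<gamma>(2)
      tendsto_imp_eventually_ne[of \<gamma> "\<gamma> t" "nhds t" 0]
    by (simp add: continuous_within tendsto_nhds_iff)
  then have "eventually (\<lambda>s. (\<Sum>b\<in>Basis. (w s \<bullet> b) *\<^sub>R sphere_diff f (\<gamma> s) b)
      = sphere_diff f (\<gamma> s) (w s)) (nhds t)"
    by (rule eventually_mono) (simp add: expand[symmetric])
  ultimately show ?thesis
    by (subst has_vector_derivative_cong_ev[symmetric]) (auto dest: eventually_nhds_x_imp_x)
qed

text \<open>The term with \<open>w'\<close> in the product rule is tangential to the image, so that the second fundamental form
  can be read off from second derivatives of the image curves.\<close>
lemma second_fund_curve: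
  assumes "(\<gamma> has_vector_derivative \<gamma>') (at t)" "\<gamma> t \<noteq> 0" "(w has_vector_derivative w') (at t)"
    and "((\<lambda>s. sphere_diff f (\<gamma> s) (w s)) has_vector_derivative y) (at t)"
  shows "second_fund f (\<gamma> t) \<gamma>' (w t) = y \<bullet> sgn (normal_vec f (\<gamma> t))"
proof -
  have "y = frechet_derivative (\<lambda>x. sphere_diff f x (w t)) (at (\<gamma> t)) \<gamma>' + sphere_diff f (\<gamma> t) w'"
    using vector_derivative_unique_at[OF assms(4) curve_has_vector_derivative2[OF assms(1-3)]] .
  then show ?thesis
    using sphere_diff_normal[OF assms(2), of w']
    by (simp add: second_fund_def inner_add_left sgn_div_norm)
qed

lemma second_fund_combination:
  assumes "p \<noteq> 0"
  shows "second_fund f p (x *\<^sub>R a + y *\<^sub>R b) w = x * second_fund f p a w + y * second_fund f p b w"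
    and "second_fund f p w (x *\<^sub>R a + y *\<^sub>R b) = x * second_fund f p w a + y * second_fund f p w b"
proof -
  have lin: "linear (frechet_derivative (\<lambda>q. sphere_diff f q w) (at p))" for w
    by (rule has_derivative_linear[OF has_derivative2[OF assms]])
  show "second_fund f p (x *\<^sub>R a + y *\<^sub>R b) w = x * second_fund f p a w + y * second_fund f p b w"
    by (simp add: second_fund_def linear_add[OF lin] linear_scale[OF lin] inner_add_left)
  have "((\<lambda>q. x *\<^sub>R sphere_diff f q a + y *\<^sub>R sphere_diff f q b) has_derivative
     (\<lambda>v. x *\<^sub>R frechet_derivative (\<lambda>q. sphere_diff f q a) (at p) v
        + y *\<^sub>R frechet_derivative (\<lambda>q. sphere_diff f q b) (at p) v)) (at p)"
    by (intro has_derivative_add has_derivative_scaleR_right has_derivative2 assms)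
  then have "((\<lambda>q. sphere_diff f q (x *\<^sub>R a + y *\<^sub>R b)) has_derivative
     (\<lambda>v. x *\<^sub>R frechet_derivative (\<lambda>q. sphere_diff f q a) (at p) v
        + y *\<^sub>R frechet_derivative (\<lambda>q. sphere_diff f q b) (at p) v)) (at p)"
    by (rule has_derivative_transform_within_open[OF _ open_nonzero])
       (use assms in \<open>auto simp: linear_add[OF linear] linear_scale[OF linear]\<close>)
  then show "second_fund f p w (x *\<^sub>R a + y *\<^sub>R b) = x * second_fund f p w a + y * second_fund f p w b"
    by (simp add: second_fund_def frechet_derivative_at[symmetric] inner_add_left)
qed

lemma first_fund_combination:
  assumes "p \<noteq> 0"
  shows "first_fund f p (x *\<^sub>R a + y *\<^sub>R b) w = x * first_fund f p a w + y * first_fund f p b w"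
    and "first_fund f p w (x *\<^sub>R a + y *\<^sub>R b) = x * first_fund f p w a + y * first_fund f p w b"
  by (simp_all add: first_fund_def linear_add[OF linear] linear_scale[OF linear] assms
      inner_add_left inner_add_right)

text \<open>In an orthogonal and conjugate tangent frame, the principal curvatures are the ratios of the diagonal
  entries of the two fundamental forms. If both ratios agree, the maximum and the minimum still
  have the right sum.\<close>
lemma mean_curvature_diagonal:
  assumes "p \<noteq> 0" and tangent: "a \<in> sphere_tangent p" "b \<in> sphere_tangent p"
    and span: "\<And>v. v \<in> sphere_tangent p \<Longrightarrow> \<exists>x y. v = x *\<^sub>R a + y *\<^sub>R b"
    and I: "first_fund f p a b = 0" "0 < first_fund f p a a" "0 < first_fund f p b b"
    and II: "second_fund f p a b = 0" "second_fund f p b a = 0"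
  shows "mean_curvature f p
    = (second_fund f p a a / first_fund f p a a + second_fund f p b b / first_fund f p b b) / 2"
proof -
  note lin = first_fund_combination[OF assms(1)] second_fund_combination[OF assms(1)]
  have I': "first_fund f p b a = 0" using I(1) by (simp add: first_fund_def inner_commute)
  let ?k = "second_fund f p a a / first_fund f p a a" and ?l = "second_fund f p b b / first_fund f p b b"
  have k: "?k \<in> principal_curvatures f p"
  proof -
    have "second_fund f p a w = ?k * first_fund f p a w" if w: "w \<in> sphere_tangent p" for w
    proof -
      obtain x y where "w = x *\<^sub>R a + y *\<^sub>R b" using span[OF w] by blast
      then show ?thesis using I II by (simp add: lin)
    qed
    moreover have "a \<noteq> 0" using I(2) linear_0[OF linear[OF assms(1)]] by (auto simp: first_fund_def)
    ultimately show ?thesis using tangent unfolding principal_curvatures_def by blast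
  qed
  have l: "?l \<in> principal_curvatures f p"
  proof -
    have "second_fund f p b w = ?l * first_fund f p b w" if w: "w \<in> sphere_tangent p" for w
    proof -
      obtain x y where "w = x *\<^sub>R a + y *\<^sub>R b" using span[OF w] by blast
      then show ?thesis using I I' II by (simp add: lin)
    qed
    moreover have "b \<noteq> 0" using I(3) linear_0[OF linear[OF assms(1)]] by (auto simp: first_fund_def)
    ultimately show ?thesis using tangent unfolding principal_curvatures_def by blast
  qed
  have "\<kappa> = ?k \<or> \<kappa> = ?l" if \<kappa>: "\<kappa> \<in> principal_curvatures f p" for \<kappa>
  proof -
    obtain v where v: "v \<in> sphere_tangent p" "v \<noteq> 0"
      and eq: "\<And>w. w \<in> sphere_tangent p \<Longrightarrow> second_fund f p v w = \<kappa> * first_fund f p v w"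
      using \<kappa> unfolding principal_curvatures_def by blast
    obtain x y where xy: "v = x *\<^sub>R a + y *\<^sub>R b" using span[OF v(1)] by blast
    have "x * second_fund f p a a = x * (\<kappa> * first_fund f p a a)"
      using eq[OF tangent(1)] I' II by (simp add: xy lin algebra_simps)
    moreover have "y * second_fund f p b b = y * (\<kappa> * first_fund f p b b)"
      using eq[OF tangent(2)] I II by (simp add: xy lin algebra_simps)
    moreover have "x \<noteq> 0 \<or> y \<noteq> 0" using v(2) xy by auto
    ultimately show ?thesis using I(2,3) by (auto simp: field_simps)
  qed
  with k l have "principal_curvatures f p = {?k, ?l}" by blast
  then show ?thesis by (simp add: mean_curvature_def max_def min_def)
qed

end

section \<open>Polar parametrizations and surfaces of revolution\<close>

lemma has_vector_derivative_vector3: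
  assumes "(x has_real_derivative x') (at t)" "(y has_real_derivative y') (at t)"
    "(z has_real_derivative z') (at t)"
  shows "((\<lambda>s. vector [x s, y s, z s] :: real^3) has_vector_derivative vector [x', y', z']) (at t)"
proof -
  have eq: "vector [a, b, c] = a *\<^sub>R axis 1 1 + b *\<^sub>R axis 2 1 + c *\<^sub>R (axis 3 1 :: real^3)"
    for a b c :: real
    by (simp add: vec_eq_iff forall_3 axis_def)
  have "((\<lambda>s. u s *\<^sub>R v) has_vector_derivative u' *\<^sub>R v) (at t)"
    if "(u has_real_derivative u') (at t)" for u u' and v :: "real^3"
    using has_vector_derivative_scaleR[OF that has_vector_derivative_const, of v] by simp
  then show ?thesis
    unfolding eq using assms by (intro has_vector_derivative_add)
qed

locale polar_parametrized_sphere =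
  fixes \<Phi> :: "real \<times> real \<Rightarrow> real^3"
  assumes polar: "polar_parametrization \<Phi>"
begin

definition "\<Phi>\<^sub>t z = frechet_derivative \<Phi> (at z) (1, 0)"
definition "\<Phi>\<^sub>\<phi> z = frechet_derivative \<Phi> (at z) (0, 1)"

lemma Ck_on_polar: "Ck_on k ({0<..<1} \<times> UNIV) \<Phi>"
proof -
  obtain U g where U: "open U" "{0<..<1} \<times> UNIV \<subseteq> U" and g: "\<And>k. Ck_on k U g"
    and eq: "\<And>x. x \<in> {0<..<1} \<times> UNIV \<Longrightarrow> g x = \<Phi> x"
    using polar unfolding polar_parametrization_def smooth_on_def by blast
  show ?thesis
    by (rule Ck_on_cong[OF _ Ck_on_subset[OF g U(2)] eq]) (auto intro: open_Times)
qed

lemma polar_has_derivative: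
  assumes "t \<in> {0<..<1}"
  shows "(\<Phi> has_derivative (\<lambda>v. fst v *\<^sub>R \<Phi>\<^sub>t (t, \<phi>) + snd v *\<^sub>R \<Phi>\<^sub>\<phi> (t, \<phi>))) (at (t, \<phi>))"
proof -
  have D: "(\<Phi> has_derivative frechet_derivative \<Phi> (at (t, \<phi>))) (at (t, \<phi>))"
    using assms by (intro Ck_on_Suc_has_derivative[OF Ck_on_polar]) auto
  have "frechet_derivative \<Phi> (at (t, \<phi>)) v = fst v *\<^sub>R \<Phi>\<^sub>t (t, \<phi>) + snd v *\<^sub>R \<Phi>\<^sub>\<phi> (t, \<phi>)" for v
  proof -
    have "v = fst v *\<^sub>R (1, 0) + snd v *\<^sub>R (0, 1)" by (simp add: prod_eq_iff)
    then have "frechet_derivative \<Phi> (at (t, \<phi>)) v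
        = frechet_derivative \<Phi> (at (t, \<phi>)) (fst v *\<^sub>R (1, 0) + snd v *\<^sub>R (0, 1))" by simp
    then show ?thesis
      by (simp only: linear_add[OF has_derivative_linear[OF D]]
          linear_scale[OF has_derivative_linear[OF D]] \<Phi>\<^sub>t_def \<Phi>\<^sub>\<phi>_def)
  qed
  then have "frechet_derivative \<Phi> (at (t, \<phi>)) = (\<lambda>v. fst v *\<^sub>R \<Phi>\<^sub>t (t, \<phi>) + snd v *\<^sub>R \<Phi>\<^sub>\<phi> (t, \<phi>))"
    by (rule ext)
  with D show ?thesis by simp
qed

lemma coordinate_curves:
  fixes g :: "real \<times> real \<Rightarrow> 'b::real_normed_vector"
  assumes "(g has_derivative D) (at (t, \<phi>))"
  shows "((\<lambda>s. g (s, \<phi>)) has_vector_derivative D (1, 0)) (at t)"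
    and "((\<lambda>s. g (t, s)) has_vector_derivative D (0, 1)) (at \<phi>)"
proof -
  have lin: "D (a *\<^sub>R v) = a *\<^sub>R D v" for a v
    by (rule linear_scale[OF has_derivative_linear[OF assms]])
  have 1: "((\<lambda>s. (s, \<phi>)) has_derivative (\<lambda>s. (s, 0))) (at t)"
    by (auto intro!: derivative_eq_intros)
  have 2: "((\<lambda>s. (t, s)) has_derivative (\<lambda>s. (0, s))) (at \<phi>)"
    by (auto intro!: derivative_eq_intros)
  show "((\<lambda>s. g (s, \<phi>)) has_vector_derivative D (1, 0)) (at t)"
    using has_derivative_compose[OF 1 assms]
    by (simp add: has_vector_derivative_def lin[symmetric])
  show "((\<lambda>s. g (t, s)) has_vector_derivative D (0, 1)) (at \<phi>)"
    using has_derivative_compose[OF 2 assms]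
    by (simp add: has_vector_derivative_def lin[symmetric])
qed

lemma partial_curves:
  assumes "t \<in> {0<..<1}"
  shows "((\<lambda>s. \<Phi> (s, \<phi>)) has_vector_derivative \<Phi>\<^sub>t (t, \<phi>)) (at t)"
    and "((\<lambda>s. \<Phi> (t, s)) has_vector_derivative \<Phi>\<^sub>\<phi> (t, \<phi>)) (at \<phi>)"
  using coordinate_curves[OF polar_has_derivative[OF assms]] by simp_all

lemma second_partial_curves:
  assumes "t \<in> {0<..<1}"
  shows "\<exists>w. ((\<lambda>s. \<Phi>\<^sub>t (s, \<phi>)) has_vector_derivative w) (at t)"
    "\<exists>w. ((\<lambda>s. \<Phi>\<^sub>t (t, s)) has_vector_derivative w) (at \<phi>)"
    "\<exists>w. ((\<lambda>s. \<Phi>\<^sub>\<phi> (s, \<phi>)) has_vector_derivative w) (at t)"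
    "\<exists>w. ((\<lambda>s. \<Phi>\<^sub>\<phi> (t, s)) has_vector_derivative w) (at \<phi>)"
proof -
  have D: "((\<lambda>z. frechet_derivative \<Phi> (at z) v) has_derivative
      frechet_derivative (\<lambda>z. frechet_derivative \<Phi> (at z) v) (at (t, \<phi>))) (at (t, \<phi>))" for v
    using assms by (intro Ck_on_Suc_has_derivative[OF Ck_on_Suc_derivative[OF Ck_on_polar]]) auto
  show "\<exists>w. ((\<lambda>s. \<Phi>\<^sub>t (s, \<phi>)) has_vector_derivative w) (at t)"
    "\<exists>w. ((\<lambda>s. \<Phi>\<^sub>t (t, s)) has_vector_derivative w) (at \<phi>)"
    "\<exists>w. ((\<lambda>s. \<Phi>\<^sub>\<phi> (s, \<phi>)) has_vector_derivative w) (at t)"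
    "\<exists>w. ((\<lambda>s. \<Phi>\<^sub>\<phi> (t, s)) has_vector_derivative w) (at \<phi>)"
    unfolding \<Phi>\<^sub>t_def \<Phi>\<^sub>\<phi>_def using coordinate_curves[OF D] by blast+
qed

lemma polar_on_sphere:
  assumes "t \<in> {0..1}"
  shows "norm (\<Phi> (t, \<phi>)) = 1" "\<Phi> (t, \<phi>) \<noteq> 0" "sgn (\<Phi> (t, \<phi>)) = \<Phi> (t, \<phi>)"
proof -
  have "\<Phi> (t, \<phi>) \<in> sphere 0 1"
    using polar assms unfolding polar_parametrization_def by blast
  then show "norm (\<Phi> (t, \<phi>)) = 1" by simp
  then show "\<Phi> (t, \<phi>) \<noteq> 0" "sgn (\<Phi> (t, \<phi>)) = \<Phi> (t, \<phi>)"
    by (auto simp: sgn_div_norm)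
qed

text \<open>Differentiate \<open>\<gamma> \<bullet> \<gamma> = 1\<close>.\<close>
lemma unit_curve_orthogonal:
  fixes \<gamma> :: "real \<Rightarrow> 'a::real_inner"
  assumes "(\<gamma> has_vector_derivative \<gamma>') (at t)" "open S" "t \<in> S" "\<And>s. s \<in> S \<Longrightarrow> norm (\<gamma> s) = 1"
  shows "\<gamma>' \<bullet> \<gamma> t = 0"
proof -
  have "((\<lambda>s. \<gamma> s \<bullet> \<gamma> s) has_vector_derivative (\<gamma> t \<bullet> \<gamma>' + \<gamma>' \<bullet> \<gamma> t)) (at t)"
    by (rule bounded_bilinear.has_vector_derivative[OF bounded_bilinear_inner assms(1,1)])
  then have "((\<lambda>s. 1 :: real) has_vector_derivative (\<gamma> t \<bullet> \<gamma>' + \<gamma>' \<bullet> \<gamma> t)) (at t)"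
    by (rule has_vector_derivative_transform_within_open[OF _ assms(2,3)])
       (use assms(4) in \<open>simp add: norm_eq_1\<close>)
  then have "\<gamma> t \<bullet> \<gamma>' + \<gamma>' \<bullet> \<gamma> t = 0"
    using vector_derivative_unique_at[OF _ has_vector_derivative_const] by blast
  then show ?thesis by (simp add: inner_commute)
qed

lemma partial_tangent:
  assumes "t \<in> {0<..<1}"
  shows "\<Phi>\<^sub>t (t, \<phi>) \<bullet> \<Phi> (t, \<phi>) = 0" "\<Phi>\<^sub>\<phi> (t, \<phi>) \<bullet> \<Phi> (t, \<phi>) = 0"
proof -
  show "\<Phi>\<^sub>t (t, \<phi>) \<bullet> \<Phi> (t, \<phi>) = 0"
    by (rule unit_curve_orthogonal[OF partial_curves(1)[OF assms], of "{0<..<1}"])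
       (use assms polar_on_sphere in auto)
  show "\<Phi>\<^sub>\<phi> (t, \<phi>) \<bullet> \<Phi> (t, \<phi>) = 0"
    by (rule unit_curve_orthogonal[OF partial_curves(2)[OF assms], of UNIV])
       (use assms polar_on_sphere in auto)
qed

lemma partial_independent:
  assumes "t \<in> {0<..<1}" "x *\<^sub>R \<Phi>\<^sub>t (t, \<phi>) + y *\<^sub>R \<Phi>\<^sub>\<phi> (t, \<phi>) = 0"
  shows "x = 0 \<and> y = 0"
proof -
  let ?D = "frechet_derivative \<Phi> (at (t, \<phi>))"
  have "?D = (\<lambda>v. fst v *\<^sub>R \<Phi>\<^sub>t (t, \<phi>) + snd v *\<^sub>R \<Phi>\<^sub>\<phi> (t, \<phi>))"
    by (rule frechet_derivative_at[OF polar_has_derivative[OF assms(1)], symmetric])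
  then have "?D (x, y) = ?D (0, 0)" using assms(2) by simp
  moreover have "inj ?D"
    using polar assms(1) unfolding polar_parametrization_def by auto
  ultimately have "(x, y) = (0 :: real, 0 :: real)" by (meson injD)
  then show ?thesis by simp
qed

text \<open>The signed area distortion of the polar parametrization: both partial derivatives are tangent to
  the sphere, hence their cross product is this multiple of the outer normal.\<close>
definition jac :: "real \<Rightarrow> real \<Rightarrow> real" where
  "jac t \<phi> = \<Phi> (t, \<phi>) \<bullet> cross3 (\<Phi>\<^sub>t (t, \<phi>)) (\<Phi>\<^sub>\<phi> (t, \<phi>))"

lemma jac_nonzero:
  assumes "t \<in> {0<..<1}"
  shows "jac t \<phi> \<noteq> 0"
proof
  assume "jac t \<phi> = 0"
  then have "cross3 (\<Phi>\<^sub>t (t, \<phi>)) (\<Phi>\<^sub>\<phi> (t, \<phi>)) = 0"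
    using cross3_orthogonal_unit[OF polar_on_sphere(1) partial_tangent, OF _ assms assms, of \<phi>] assms
    by (simp add: jac_def)
  then have "collinear {0, \<Phi>\<^sub>t (t, \<phi>), \<Phi>\<^sub>\<phi> (t, \<phi>)}" by (simp add: cross_eq_0)
  then consider "\<Phi>\<^sub>t (t, \<phi>) = 0" | k where "\<Phi>\<^sub>\<phi> (t, \<phi>) = k *\<^sub>R \<Phi>\<^sub>t (t, \<phi>)"
    unfolding collinear_lemma by (metis scaleR_zero_left)
  then show False
  proof cases
    case 1
    then show False using partial_independent[OF assms, of 1 \<phi> 0] by simp
  next
    case 2
    then show False using partial_independent[OF assms, of k \<phi> "-1"] by simp
  qed
qed

lemma partial_span:
  assumes t: "t \<in> {0<..<1}" and v: "v \<bullet> \<Phi> (t, \<phi>) = 0"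
  shows "\<exists>x y. v = x *\<^sub>R \<Phi>\<^sub>t (t, \<phi>) + y *\<^sub>R \<Phi>\<^sub>\<phi> (t, \<phi>)"
proof -
  let ?p = "\<Phi> (t, \<phi>)" and ?a = "\<Phi>\<^sub>t (t, \<phi>)" and ?b = "\<Phi>\<^sub>\<phi> (t, \<phi>)"
  have "(v \<bullet> cross3 ?a ?b) *\<^sub>R ?p + (v \<bullet> cross3 ?b ?p) *\<^sub>R ?a + (v \<bullet> cross3 ?p ?a) *\<^sub>R ?b
      = (?p \<bullet> cross3 ?a ?b) *\<^sub>R v"
    unfolding vec_eq_iff forall_3 inner_vec_def sum_3 cross3_def
    by (simp, intro conjI; algebra)
  moreover have "v \<bullet> cross3 ?a ?b = 0"
    by (subst cross3_orthogonal_unit[OF polar_on_sphere(1) partial_tangent]) (use t v in auto)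
  ultimately have "jac t \<phi> *\<^sub>R v = (v \<bullet> cross3 ?b ?p) *\<^sub>R ?a + (v \<bullet> cross3 ?p ?a) *\<^sub>R ?b"
    by (simp add: jac_def)
  then have "inverse (jac t \<phi>) *\<^sub>R (jac t \<phi> *\<^sub>R v) =
      inverse (jac t \<phi>) *\<^sub>R ((v \<bullet> cross3 ?b ?p) *\<^sub>R ?a + (v \<bullet> cross3 ?p ?a) *\<^sub>R ?b)" by simp
  then have "v = (inverse (jac t \<phi>) * (v \<bullet> cross3 ?b ?p)) *\<^sub>R ?a
      + (inverse (jac t \<phi>) * (v \<bullet> cross3 ?p ?a)) *\<^sub>R ?b"
    using jac_nonzero[OF t, of \<phi>] by (simp add: scaleR_add_right)
  then show ?thesis by blast
qed

end

text \<open>The functions \<open>r', h', r'', h''\<close> are only assumed to be derivatives in the interior of the parameter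
  interval, since all curvature computations avoid the poles.\<close>
locale revolution = polar_parametrized_sphere + smooth_sphere_map +
  fixes r h r' h' r'' h'' :: "real \<Rightarrow> real"
  assumes profile: "\<And>t \<phi>. t \<in> {0..1} \<Longrightarrow> f (\<Phi> (t, \<phi>)) = vector [r t * cos \<phi>, r t * sin \<phi>, h t]"
    and r: "\<And>t. t \<in> {0<..<1} \<Longrightarrow> (r has_real_derivative r' t) (at t)"
    and h: "\<And>t. t \<in> {0<..<1} \<Longrightarrow> (h has_real_derivative h' t) (at t)"
    and r': "\<And>t. t \<in> {0<..<1} \<Longrightarrow> (r' has_real_derivative r'' t) (at t)"
    and h': "\<And>t. t \<in> {0<..<1} \<Longrightarrow> (h' has_real_derivative h'' t) (at t)"
    and cont_r'': "continuous_on {0<..<1} r''" and cont_h'': "continuous_on {0<..<1} h''"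
    and r_pos: "\<And>t. t \<in> {0<..<1} \<Longrightarrow> 0 < r t"
    and regular: "\<And>t. t \<in> {0<..<1} \<Longrightarrow> r' t \<noteq> 0 \<or> h' t \<noteq> 0"
begin

definition speed :: "real \<Rightarrow> real" where "speed t = sqrt ((r' t)\<^sup>2 + (h' t)\<^sup>2)"

lemma speed_pos: "t \<in> {0<..<1} \<Longrightarrow> 0 < speed t"
  using regular[of t] by (auto simp: speed_def sum_power2_gt_zero_iff)

lemma speed_squared: "(speed t)\<^sup>2 = (r' t)\<^sup>2 + (h' t)\<^sup>2"
  by (simp add: speed_def)

lemma diff_partial_t:
  assumes t: "t \<in> {0<..<1}"
  shows "sphere_diff f (\<Phi> (t, \<phi>)) (\<Phi>\<^sub>t (t, \<phi>)) = vector [r' t * cos \<phi>, r' t * sin \<phi>, h' t]"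
proof (rule vector_derivative_unique_at)
  show "((\<lambda>s. f (sgn (\<Phi> (s, \<phi>)))) has_vector_derivative
      sphere_diff f (\<Phi> (t, \<phi>)) (\<Phi>\<^sub>t (t, \<phi>))) (at t)"
    by (rule curve_has_vector_derivative[OF partial_curves(1)[OF t]]) (use t polar_on_sphere in auto)
  have "((\<lambda>s. vector [r s * cos \<phi>, r s * sin \<phi>, h s] :: real^3) has_vector_derivative
      vector [r' t * cos \<phi>, r' t * sin \<phi>, h' t]) (at t)"
    by (intro has_vector_derivative_vector3 DERIV_cmult_right r h t)
  then show "((\<lambda>s. f (sgn (\<Phi> (s, \<phi>)))) has_vector_derivative
      vector [r' t * cos \<phi>, r' t * sin \<phi>, h' t]) (at t)"
    by (rule has_vector_derivative_transform_within_open[of _ _ _ "{0<..<1}"])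
       (use t in \<open>auto simp: polar_on_sphere profile\<close>)
qed

lemma diff_partial_phi:
  assumes t: "t \<in> {0<..<1}"
  shows "sphere_diff f (\<Phi> (t, \<phi>)) (\<Phi>\<^sub>\<phi> (t, \<phi>)) = vector [- r t * sin \<phi>, r t * cos \<phi>, 0]"
proof (rule vector_derivative_unique_at)
  show "((\<lambda>s. f (sgn (\<Phi> (t, s)))) has_vector_derivative
      sphere_diff f (\<Phi> (t, \<phi>)) (\<Phi>\<^sub>\<phi> (t, \<phi>))) (at \<phi>)"
    by (rule curve_has_vector_derivative[OF partial_curves(2)[OF t]]) (use t polar_on_sphere in auto)
  have "((\<lambda>s. vector [r t * cos s, r t * sin s, h t] :: real^3) has_vector_derivative
      vector [- r t * sin \<phi>, r t * cos \<phi>, 0]) (at \<phi>)"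
    by (intro has_vector_derivative_vector3) (auto intro!: derivative_eq_intros)
  then show "((\<lambda>s. f (sgn (\<Phi> (t, s)))) has_vector_derivative
      vector [- r t * sin \<phi>, r t * cos \<phi>, 0]) (at \<phi>)"
    using t by (simp add: polar_on_sphere profile)
qed

lemma second_fund_partials:
  fixes \<phi> :: real
  assumes t: "t \<in> {0<..<1}"
  defines "p \<equiv> \<Phi> (t, \<phi>)" and "a \<equiv> \<Phi>\<^sub>t (t, \<phi>)" and "b \<equiv> \<Phi>\<^sub>\<phi> (t, \<phi>)"
    and "n \<equiv> sgn (normal_vec f (\<Phi> (t, \<phi>)))"
  shows "second_fund f p a a = vector [r'' t * cos \<phi>, r'' t * sin \<phi>, h'' t] \<bullet> n"
    "second_fund f p a b = vector [- r' t * sin \<phi>, r' t * cos \<phi>, 0] \<bullet> n"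
    "second_fund f p b a = vector [- r' t * sin \<phi>, r' t * cos \<phi>, 0] \<bullet> n"
    "second_fund f p b b = vector [- r t * cos \<phi>, - r t * sin \<phi>, 0] \<bullet> n"
proof -
  have p: "\<Phi> (t, \<phi>) \<noteq> 0" using polar_on_sphere t by auto
  note sp = second_partial_curves[OF t, of \<phi>]
  have tr: "((\<lambda>s. F s) has_vector_derivative y) (at t)"
    if "(G has_vector_derivative y) (at t)" "\<And>s. s \<in> {0<..<1} \<Longrightarrow> G s = F s"
    for F G :: "real \<Rightarrow> real^3" and y
    by (rule has_vector_derivative_transform_within_open[OF that(1), of "{0<..<1}"])
       (use t that(2) in auto)
  obtain w where w: "((\<lambda>s. \<Phi>\<^sub>t (s, \<phi>)) has_vector_derivative w) (at t)" using sp(1) by blast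
  have "((\<lambda>s. vector [r' s * cos \<phi>, r' s * sin \<phi>, h' s] :: real^3) has_vector_derivative
      vector [r'' t * cos \<phi>, r'' t * sin \<phi>, h'' t]) (at t)"
    by (intro has_vector_derivative_vector3 DERIV_cmult_right r' h' t)
  then have "((\<lambda>s. sphere_diff f (\<Phi> (s, \<phi>)) (\<Phi>\<^sub>t (s, \<phi>))) has_vector_derivative
      vector [r'' t * cos \<phi>, r'' t * sin \<phi>, h'' t]) (at t)"
    by (rule tr) (simp add: diff_partial_t)
  from second_fund_curve[OF partial_curves(1)[OF t] p w this]
  show "second_fund f p a a = vector [r'' t * cos \<phi>, r'' t * sin \<phi>, h'' t] \<bullet> n"
    by (simp add: p_def a_def b_def n_def)
  obtain w where w: "((\<lambda>s. \<Phi>\<^sub>\<phi> (s, \<phi>)) has_vector_derivative w) (at t)" using sp(3) by blast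
  have "((\<lambda>s. vector [- r s * sin \<phi>, r s * cos \<phi>, 0] :: real^3) has_vector_derivative
      vector [- r' t * sin \<phi>, r' t * cos \<phi>, 0]) (at t)"
    by (intro has_vector_derivative_vector3 DERIV_cmult_right DERIV_minus DERIV_const r t)
  then have "((\<lambda>s. sphere_diff f (\<Phi> (s, \<phi>)) (\<Phi>\<^sub>\<phi> (s, \<phi>))) has_vector_derivative
      vector [- r' t * sin \<phi>, r' t * cos \<phi>, 0]) (at t)"
    by (rule tr) (simp add: diff_partial_phi)
  from second_fund_curve[OF partial_curves(1)[OF t] p w this]
  show "second_fund f p a b = vector [- r' t * sin \<phi>, r' t * cos \<phi>, 0] \<bullet> n"
    by (simp add: p_def a_def b_def n_def)
  obtain w where w: "((\<lambda>s. \<Phi>\<^sub>t (t, s)) has_vector_derivative w) (at \<phi>)" using sp(2) by blast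
  have "((\<lambda>s. vector [r' t * cos s, r' t * sin s, h' t] :: real^3) has_vector_derivative
      vector [- r' t * sin \<phi>, r' t * cos \<phi>, 0]) (at \<phi>)"
    by (intro has_vector_derivative_vector3) (auto intro!: derivative_eq_intros)
  then have "((\<lambda>s. sphere_diff f (\<Phi> (t, s)) (\<Phi>\<^sub>t (t, s))) has_vector_derivative
      vector [- r' t * sin \<phi>, r' t * cos \<phi>, 0]) (at \<phi>)"
    using t by (simp add: diff_partial_t)
  from second_fund_curve[OF partial_curves(2)[OF t] p w this]
  show "second_fund f p b a = vector [- r' t * sin \<phi>, r' t * cos \<phi>, 0] \<bullet> n"
    by (simp add: p_def a_def b_def n_def)
  obtain w where w: "((\<lambda>s. \<Phi>\<^sub>\<phi> (t, s)) has_vector_derivative w) (at \<phi>)" using sp(4) by blast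
  have "((\<lambda>s. vector [- r t * sin s, r t * cos s, 0] :: real^3) has_vector_derivative
      vector [- r t * cos \<phi>, - r t * sin \<phi>, 0]) (at \<phi>)"
    by (intro has_vector_derivative_vector3) (auto intro!: derivative_eq_intros)
  then have "((\<lambda>s. sphere_diff f (\<Phi> (t, s)) (\<Phi>\<^sub>\<phi> (t, s))) has_vector_derivative
      vector [- r t * cos \<phi>, - r t * sin \<phi>, 0]) (at \<phi>)"
    using t by (simp add: diff_partial_phi)
  from second_fund_curve[OF partial_curves(2)[OF t] p w this]
  show "second_fund f p b b = vector [- r t * cos \<phi>, - r t * sin \<phi>, 0] \<bullet> n"
    by (simp add: p_def a_def b_def n_def)
qed

text \<open>The tangent of the meridian turned by a right angle in the half plane of angle \<open>\<phi>\<close>: a normal of the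
  surface, of length equal to the speed.\<close>
definition frame :: "real \<Rightarrow> real \<Rightarrow> real^3" where
  "frame t \<phi> = vector [- h' t * cos \<phi>, - h' t * sin \<phi>, r' t]"

lemma norm_frame: "norm (frame t \<phi>) = speed t"
proof -
  have cs: "cos \<phi> * cos \<phi> = 1 - sin \<phi> * sin \<phi>"
    using sin_cos_squared_add3[of \<phi>] by linarith
  have "frame t \<phi> \<bullet> frame t \<phi> = (r' t)\<^sup>2 + (h' t)\<^sup>2"
    unfolding frame_def inner_vec_def sum_3 by (simp add: power2_eq_square, use cs in algebra)
  then show ?thesis by (simp add: norm_eq_sqrt_inner speed_def)
qed

lemma jac_normal_vec:
  assumes t: "t \<in> {0<..<1}"
  shows "jac t \<phi> *\<^sub>R normal_vec f (\<Phi> (t, \<phi>)) = r t *\<^sub>R frame t \<phi>"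
proof -
  have "jac t \<phi> *\<^sub>R normal_vec f (\<Phi> (t, \<phi>))
      = cross3 (vector [r' t * cos \<phi>, r' t * sin \<phi>, h' t]) (vector [- r t * sin \<phi>, r t * cos \<phi>, 0])"
    unfolding jac_def diff_partial_t[OF t, symmetric] diff_partial_phi[OF t, symmetric]
    by (rule cross3_sphere_diff[symmetric]) (use t polar_on_sphere partial_tangent in auto)
  also have "\<dots> = r t *\<^sub>R frame t \<phi>"
  proof -
    have "r' t * (r t * (cos \<phi> * cos \<phi>)) + r' t * (r t * (sin \<phi> * sin \<phi>)) = r t * r' t"
      using sin_cos_squared_add[of \<phi>] by (simp add: power2_eq_square) algebra
    then show ?thesis
      unfolding frame_def vec_eq_iff forall_3 cross3_def by (simp add: algebra_simps)
  qed
  finally show ?thesis .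
qed

lemma jac_norm_normal_vec:
  assumes t: "t \<in> {0<..<1}"
  shows "\<bar>jac t \<phi>\<bar> * norm (normal_vec f (\<Phi> (t, \<phi>))) = r t * speed t"
proof -
  have "norm (jac t \<phi> *\<^sub>R normal_vec f (\<Phi> (t, \<phi>))) = norm (r t *\<^sub>R frame t \<phi>)"
    unfolding jac_normal_vec[OF t] ..
  then show ?thesis using r_pos[OF t] by (simp add: norm_frame)
qed

text \<open>The polar parametrization may reverse the orientation. This only affects the sign of the unit
  normal, hence of the mean curvature, and disappears in its square.\<close>
lemma sgn_normal_vec:
  assumes t: "t \<in> {0<..<1}"
  shows "sgn (normal_vec f (\<Phi> (t, \<phi>))) = (sgn (jac t \<phi>) / speed t) *\<^sub>R frame t \<phi>"
proof -
  let ?N = "normal_vec f (\<Phi> (t, \<phi>))"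
  have "sgn (jac t \<phi> *\<^sub>R ?N) = sgn (r t *\<^sub>R frame t \<phi>)"
    unfolding jac_normal_vec[OF t] ..
  then have "sgn (jac t \<phi>) *\<^sub>R sgn ?N = (1 / speed t) *\<^sub>R frame t \<phi>"
    using r_pos[OF t] by (simp add: sgn_scaleR sgn_div_norm[of "frame t \<phi>"] norm_frame divide_inverse)
  then have "sgn (jac t \<phi>) *\<^sub>R sgn (jac t \<phi>) *\<^sub>R sgn ?N = sgn (jac t \<phi>) *\<^sub>R (1 / speed t) *\<^sub>R frame t \<phi>"
    by simp
  then show ?thesis using jac_nonzero[OF t, of \<phi>] by (simp add: sgn_if split: if_splits)
qed

text \<open>This is the derivative of the tangent angle with respect to the curve parameter, that is the
  curvature of the profile times the speed.\<close>
definition turning_rate :: "real \<Rightarrow> real" where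
  "turning_rate t = (r' t * h'' t - h' t * r'' t) / (speed t)\<^sup>2"

lemma mean_curvature_revolution:
  assumes t: "t \<in> {0<..<1}"
  shows "(mean_curvature f (\<Phi> (t, \<phi>)))\<^sup>2 = ((r t * turning_rate t + h' t) / (2 * (r t * speed t)))\<^sup>2"
proof -
  let ?p = "\<Phi> (t, \<phi>)" and ?a = "\<Phi>\<^sub>t (t, \<phi>)" and ?b = "\<Phi>\<^sub>\<phi> (t, \<phi>)" and ?s = "sgn (jac t \<phi>)"
  note II = second_fund_partials[OF t, of \<phi>, unfolded sgn_normal_vec[OF t] frame_def]
  have cs: "cos \<phi> * cos \<phi> = 1 - sin \<phi> * sin \<phi>"
    using sin_cos_squared_add3[of \<phi>] by linarith
  have Iaa: "first_fund f ?p ?a ?a = (speed t)\<^sup>2"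
    unfolding first_fund_def diff_partial_t[OF t] inner_vec_def sum_3 speed_squared
    by (simp add: power2_eq_square, use cs in algebra)
  have Ibb: "first_fund f ?p ?b ?b = (r t)\<^sup>2"
    unfolding first_fund_def diff_partial_phi[OF t] inner_vec_def sum_3 power2_eq_square
    by (simp, use cs in algebra)
  have Iab: "first_fund f ?p ?a ?b = 0"
    unfolding first_fund_def diff_partial_t[OF t] diff_partial_phi[OF t] inner_vec_def sum_3
    by simp
  have IIab: "second_fund f ?p ?a ?b = 0" "second_fund f ?p ?b ?a = 0"
    unfolding II inner_vec_def sum_3 by (simp_all add: algebra_simps)
  have IIaa: "second_fund f ?p ?a ?a = ?s / speed t * (r' t * h'' t - h' t * r'' t)"
    unfolding II inner_vec_def sum_3 by (simp, use cs in algebra)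
  have IIbb: "second_fund f ?p ?b ?b = ?s / speed t * (r t * h' t)"
    unfolding II inner_vec_def sum_3 by (simp, use cs in algebra)
  have "mean_curvature f ?p
    = (second_fund f ?p ?a ?a / first_fund f ?p ?a ?a + second_fund f ?p ?b ?b / first_fund f ?p ?b ?b) / 2"
  proof (rule mean_curvature_diagonal)
    show "?p \<noteq> 0" using t polar_on_sphere by auto
    show "?a \<in> sphere_tangent ?p" "?b \<in> sphere_tangent ?p"
      using partial_tangent[OF t] by (auto simp: sphere_tangent_def)
    show "\<exists>x y. v = x *\<^sub>R ?a + y *\<^sub>R ?b" if "v \<in> sphere_tangent ?p" for v
      using that by (intro partial_span[OF t]) (simp add: sphere_tangent_def)
    show "0 < first_fund f ?p ?a ?a" "0 < first_fund f ?p ?b ?b"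
      using speed_pos[OF t] r_pos[OF t] by (auto simp: Iaa Ibb)
  qed fact+
  also have "\<dots> = ?s * ((r t * turning_rate t + h' t) / (2 * (r t * speed t)))"
    unfolding Iaa Ibb IIaa IIbb turning_rate_def
    using speed_pos[OF t] r_pos[OF t] by (simp add: field_simps power2_eq_square)
  finally have "(mean_curvature f ?p)\<^sup>2 = ?s\<^sup>2 * ((r t * turning_rate t + h' t) / (2 * (r t * speed t)))\<^sup>2"
    by (simp add: power_mult_distrib power_divide)
  moreover have "?s\<^sup>2 = 1" using jac_nonzero[OF t, of \<phi>] by (simp add: sgn_if)
  ultimately show ?thesis by simp
qed

end

section \<open>The Willmore energy as an integral over the profile\<close>

lemma Basis_real3: "(Basis :: (real^3) set) = {axis 1 1, axis 2 1, axis 3 1}"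
  by (auto simp: Basis_vec_def UNIV_3)

lemma prod_Basis_real3:
  fixes g :: "real^3 \<Rightarrow> 'a::comm_monoid_mult"
  shows "(\<Prod>b\<in>Basis. g b) = g (axis 1 1) * g (axis 2 1) * g (axis 3 1)"
  unfolding Basis_real3 by (simp add: axis_eq_axis mult.assoc)

lemma nn_integral_lborel_real3:
  fixes f g k :: "real \<Rightarrow> real"
  assumes [measurable]: "f \<in> borel_measurable borel" "g \<in> borel_measurable borel" "k \<in> borel_measurable borel"
    and nonneg: "\<And>x. 0 \<le> f x" "\<And>x. 0 \<le> g x" "\<And>x. 0 \<le> k x"
  shows "(\<integral>\<^sup>+y. ennreal (f (y $ 1) * g (y $ 2) * k (y $ 3)) \<partial>(lborel :: (real^3) measure))
    = (\<integral>\<^sup>+x. ennreal (f x) \<partial>lborel) * (\<integral>\<^sup>+x. ennreal (g x) \<partial>lborel) * (\<integral>\<^sup>+x. ennreal (k x) \<partial>lborel)"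
proof -
  define F where "F b = (if b = axis 1 1 then f else if b = (axis 2 1 :: real^3) then g else k)" for b
  have F: "F (axis 1 1) = f" "F (axis 2 1) = g" "F (axis 3 1) = k"
    by (simp_all add: F_def axis_eq_axis)
  have "(\<integral>\<^sup>+y. (\<Prod>b\<in>Basis. ennreal (F b (y \<bullet> b))) \<partial>(lborel :: (real^3) measure))
      = (\<Prod>b\<in>(Basis :: (real^3) set). (\<integral>\<^sup>+x. ennreal (F b x) \<partial>lborel))"
    by (rule nn_integral_lborel_prod) (auto simp: F_def)
  then show ?thesis
    unfolding prod_Basis_real3 F
    by (simp add: inner_axis ennreal_mult[symmetric] nonneg mult_nonneg_nonneg)
qed

text \<open>Integrability of \<open>u\<close> over the image is part of the conclusion. Nonnegativity turns integrability into the
  absolute integrability that a change of variables requires. The general theorem is about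
  vector-valued functions, so scalars are treated as vectors of length one.\<close>
lemma has_integral_change_of_variables_nonneg:
  fixes u :: "real^3 \<Rightarrow> real" and g :: "real^3 \<Rightarrow> real^3"
  assumes S: "S \<in> sets lebesgue"
    and der: "\<And>x. x \<in> S \<Longrightarrow> (g has_derivative g' x) (at x within S)" and inj: "inj_on g S"
    and u: "\<And>x. x \<in> S \<Longrightarrow> 0 \<le> u (g x)"
    and I: "((\<lambda>x. \<bar>det (matrix (g' x))\<bar> * u (g x)) has_integral I) S"
  shows "(u has_integral I) (g ` S)"
proof -
  have "(\<lambda>x. \<bar>det (matrix (g' x))\<bar> * u (g x)) absolutely_integrable_on S"
    using I u by (intro nonnegative_absolutely_integrable_1) (auto simp: has_integral_integrable)
  moreover have "integral S (\<lambda>x. \<bar>det (matrix (g' x))\<bar> * u (g x)) = I"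
    using I by (rule integral_unique)
  ultimately have "(\<lambda>x. \<bar>det (matrix (g' x))\<bar> *\<^sub>R (vec (u (g x)) :: real^1)) absolutely_integrable_on S
      \<and> integral S (\<lambda>x. \<bar>det (matrix (g' x))\<bar> *\<^sub>R (vec (u (g x)) :: real^1)) = vec I"
    by (simp add: absolutely_integrable_on_1_iff integral_on_1_eq)
  then have "(\<lambda>x. vec (u x) :: real^1) absolutely_integrable_on g ` S
      \<and> integral (g ` S) (\<lambda>x. vec (u x) :: real^1) = vec I"
    by (subst (asm) has_absolute_integral_change_of_variables[OF S der inj, of "\<lambda>x. vec (u x)"])
  then have "u absolutely_integrable_on g ` S" "integral (g ` S) u = I"
    by (simp_all add: absolutely_integrable_on_1_iff integral_on_1_eq)
  then show ?thesis
    by (simp add: has_integral_iff set_lebesgue_integral_eq_integral(1))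
qed

context polar_parametrized_sphere
begin

lemma polar_eq_iff:
  assumes "t \<in> {0..1}" "t' \<in> {0..1}"
  shows "\<Phi> (t, \<phi>) = \<Phi> (t', \<phi>') \<longleftrightarrow>
     t = t' \<and> (t = 0 \<or> t = 1 \<or> (\<exists>k::int. \<phi>' = \<phi> + 2 * pi * of_int k))"
  using polar assms unfolding polar_parametrization_def by blast

lemma polar_surj:
  assumes "norm p = 1"
  obtains t \<phi> where "t \<in> {0..1}" "\<phi> \<in> {0..<2*pi}" "p = \<Phi> (t, \<phi>)"
proof -
  have "p \<in> \<Phi> ` ({0..1} \<times> UNIV)"
    using polar assms unfolding polar_parametrization_def by auto
  then obtain t \<phi> where t: "t \<in> {0..1}" and p: "p = \<Phi> (t, \<phi>)" by auto
  define k where "k = \<lfloor>\<phi> / (2 * pi)\<rfloor>"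
  have "of_int k \<le> \<phi> / (2 * pi)" "\<phi> / (2 * pi) < of_int k + 1"
    unfolding k_def by linarith+
  then have "\<phi> - 2 * pi * of_int k \<in> {0..<2*pi}"
    by (simp add: field_simps)
  moreover have "p = \<Phi> (t, \<phi> - 2 * pi * of_int k)"
    unfolding p polar_eq_iff[OF t t] by (auto intro!: exI[of _ "- k"])
  ultimately show thesis using t that by blast
qed

text \<open>The parameter \<open>t\<close> of a point on the sphere. Curvature quantities of a surface of revolution factor
  through it, and its continuity gives their measurability.\<close>
definition latitude :: "real^3 \<Rightarrow> real" where
  "latitude p = (THE t. t \<in> {0..1} \<and> (\<exists>\<phi>. p = \<Phi> (t, \<phi>)))"

lemma latitude_polar: "t \<in> {0..1} \<Longrightarrow> latitude (\<Phi> (t, \<phi>)) = t"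
  unfolding latitude_def using polar_eq_iff by (intro the_equality) blast+

text \<open>The preimage of a closed set of parameters is the image of a compact rectangle, because the angle
  may be restricted to one period.\<close>
lemma continuous_on_latitude: "continuous_on (sphere 0 1) latitude"
proof -
  have "closed (latitude -` B \<inter> sphere 0 1)" if B: "closed B" for B
  proof -
    have "latitude -` B \<inter> sphere 0 1 = \<Phi> ` ((B \<inter> {0..1}) \<times> {0..2*pi})" (is "?L = ?R")
    proof
      show "?L \<subseteq> ?R"
      proof
        fix p assume p: "p \<in> ?L"
        then obtain t \<phi> where t: "t \<in> {0..1}" "\<phi> \<in> {0..<2*pi}" "p = \<Phi> (t, \<phi>)"
          using polar_surj[of p] by auto
        moreover have "t \<in> B" using p t latitude_polar by auto
        ultimately show "p \<in> ?R" by auto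
      qed
      show "?R \<subseteq> ?L" using latitude_polar polar_on_sphere by auto
    qed
    moreover have "compact ((B \<inter> {0..1}) \<times> {0..2*pi})"
      by (intro compact_Times closed_Int_compact B) auto
    moreover have "continuous_on ((B \<inter> {0..1}) \<times> {0..2*pi}) \<Phi>"
      using polar unfolding polar_parametrization_def by (auto elim: continuous_on_subset)
    ultimately show ?thesis by (simp add: compact_continuous_image compact_imp_closed)
  qed
  then show ?thesis
    using continuous_on_closed_vimage[of "sphere 0 1" latitude] by auto
qed

text \<open>Coordinates adapted to the cone measure: radius, and the two parameters of the direction.\<close>
definition cone_map :: "real^3 \<Rightarrow> real^3" where "cone_map y = (y $ 1) *\<^sub>R \<Phi> (y $ 2, y $ 3)"

text \<open>The angle runs through a half-open period. In this way the map is injective, and only the two radii to the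
  poles are missing from its image.\<close>
definition cone_domain :: "(real^3) set" where
  "cone_domain = {y. y $ 1 \<in> {0<..<1} \<and> y $ 2 \<in> {0<..<1} \<and> y $ 3 \<in> {0..<2*pi}}"

definition cone_derivative :: "real^3 \<Rightarrow> real^3 \<Rightarrow> real^3" where
  "cone_derivative y v = (v $ 1) *\<^sub>R \<Phi> (y $ 2, y $ 3)
     + (y $ 1) *\<^sub>R ((v $ 2) *\<^sub>R \<Phi>\<^sub>t (y $ 2, y $ 3) + (v $ 3) *\<^sub>R \<Phi>\<^sub>\<phi> (y $ 2, y $ 3))"

lemma cone_map_has_derivative:
  assumes "y \<in> cone_domain"
  shows "(cone_map has_derivative cone_derivative y) (at y within S)"
proof -
  have nth: "((\<lambda>y::real^3. y $ i) has_derivative (\<lambda>v. v $ i)) (at y)" for i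
    by (rule bounded_linear_imp_has_derivative[OF bounded_linear_vec_nth])
  have "((\<lambda>y. \<Phi> (y $ 2, y $ 3)) has_derivative
      (\<lambda>v. (v $ 2) *\<^sub>R \<Phi>\<^sub>t (y $ 2, y $ 3) + (v $ 3) *\<^sub>R \<Phi>\<^sub>\<phi> (y $ 2, y $ 3))) (at y)"
    using has_derivative_compose[OF has_derivative_Pair[OF nth nth] polar_has_derivative] assms
    by (simp add: cone_domain_def)
  from has_derivative_scaleR[OF nth[of 1] this]
  have "(cone_map has_derivative cone_derivative y) (at y)"
    unfolding cone_map_def[abs_def] cone_derivative_def[abs_def] by (simp add: add.commute)
  then show ?thesis by (rule has_derivative_at_withinI)
qed

lemma det_cone_derivative:
  "det (matrix (cone_derivative y)) = (y $ 1)\<^sup>2 * jac (y $ 2) (y $ 3)"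
  unfolding det_3 matrix_def cone_derivative_def jac_def inner_vec_def sum_3 cross3_def
  by (simp add: axis_def power2_eq_square) algebra

lemma cone_domain_bounds:
  assumes "y \<in> cone_domain"
  shows "0 < y $ 1" "y $ 1 < 1" "y $ 2 \<in> {0<..<1}" "y $ 2 \<in> {0..1}" "y $ 3 \<in> {0..<2*pi}"
  using assms by (auto simp: cone_domain_def)

lemma norm_cone_map: "y \<in> cone_domain \<Longrightarrow> norm (cone_map y) = y $ 1"
  using cone_domain_bounds[of y] polar_on_sphere by (simp add: cone_map_def)

lemma sgn_cone_map: "y \<in> cone_domain \<Longrightarrow> sgn (cone_map y) = \<Phi> (y $ 2, y $ 3)"
  using cone_domain_bounds[of y] polar_on_sphere by (simp add: cone_map_def sgn_scaleR)

lemma inj_on_cone_map: "inj_on cone_map cone_domain"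
proof (rule inj_onI)
  fix y z assume y: "y \<in> cone_domain" and z: "z \<in> cone_domain" and eq: "cone_map y = cone_map z"
  note b = cone_domain_bounds[OF y] cone_domain_bounds[OF z]
  have 1: "y $ 1 = z $ 1" using eq norm_cone_map[OF y] norm_cone_map[OF z] by simp
  have "\<Phi> (y $ 2, y $ 3) = \<Phi> (z $ 2, z $ 3)"
    using eq sgn_cone_map[OF y] sgn_cone_map[OF z] by simp
  then obtain k :: int where 2: "y $ 2 = z $ 2" and k: "z $ 3 = y $ 3 + 2 * pi * of_int k"
    using b polar_eq_iff[OF b(4) b(9)] by auto
  have "0 \<le> y $ 3" "y $ 3 < 2 * pi" "0 \<le> z $ 3" "z $ 3 < 2 * pi" using b(5,10) by auto
  then have "\<bar>2 * pi * of_int k\<bar> < 2 * pi * 1" unfolding k by linarith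
  then have "\<bar>real_of_int k\<bar> < 1" by (simp add: abs_mult)
  then have "k = 0" by linarith
  then show "y = z" using 1 2 k by (simp add: vec_eq_iff forall_3)
qed

lemma cone_map_image:
  "cone_map ` cone_domain \<subseteq> ball 0 1" "negligible (ball 0 1 - cone_map ` cone_domain)"
proof -
  show "cone_map ` cone_domain \<subseteq> ball 0 1"
    using norm_cone_map cone_domain_bounds by auto
  have "ball 0 1 - cone_map ` cone_domain \<subseteq> span {\<Phi> (0, 0)} \<union> span {\<Phi> (1, 0)}"
  proof
    fix x assume x: "x \<in> ball 0 1 - cone_map ` cone_domain"
    show "x \<in> span {\<Phi> (0, 0)} \<union> span {\<Phi> (1, 0)}"
    proof (cases "x = 0")
      case True
      then show ?thesis by (simp add: span_zero)
    next
      case False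
      then obtain t \<phi> where t: "t \<in> {0..1}" "\<phi> \<in> {0..<2*pi}" "sgn x = \<Phi> (t, \<phi>)"
        using polar_surj[of "sgn x"] by (auto simp: norm_sgn)
      have x_eq: "x = norm x *\<^sub>R \<Phi> (t, \<phi>)"
        using False by (simp add: t(3)[symmetric] sgn_div_norm)
      have "t = 0 \<or> t = 1"
      proof (rule ccontr)
        assume "\<not> (t = 0 \<or> t = 1)"
        then have "vector [norm x, t, \<phi>] \<in> cone_domain"
          using t x False by (auto simp: cone_domain_def)
        moreover have "x = cone_map (vector [norm x, t, \<phi>])"
          using x_eq by (simp add: cone_map_def)
        ultimately show False using x by blast
      qed
      then have "\<Phi> (t, \<phi>) = \<Phi> (t, 0)" using polar_eq_iff[OF t(1) t(1)] by blast
      with x_eq \<open>t = 0 \<or> t = 1\<close> show ?thesis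
        by (metis UnI1 UnI2 insertI1 span_base span_scale)
    qed
  qed
  moreover have "negligible (span {a :: real^3})" for a
    by (rule negligible_lowdim) (simp add: dim_singleton)
  ultimately show "negligible (ball 0 1 - cone_map ` cone_domain)"
    by (meson negligible_Un negligible_subset)
qed

lemma sets_cone_domain: "cone_domain \<in> sets borel"
  unfolding cone_domain_def by measurable

end

context revolution
begin

definition squared_mean_curvature :: "real \<Rightarrow> real" where
  "squared_mean_curvature t = ((r t * turning_rate t + h' t) / (2 * (r t * speed t)))\<^sup>2"

lemma continuous_on_squared_mean_curvature: "continuous_on {0<..<1} squared_mean_curvature"
proof -
  have c: "continuous_on {0<..<1} r" "continuous_on {0<..<1} r'" "continuous_on {0<..<1} h'"
    by (intro continuous_at_imp_continuous_on ballI DERIV_isCont; erule r r' h')+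
  show ?thesis
    unfolding squared_mean_curvature_def turning_rate_def speed_def
    by (intro continuous_intros c cont_r'' cont_h'')
       (use r_pos regular in \<open>fastforce simp: sum_power2_eq_zero_iff\<close>)+
qed

text \<open>Away from the poles the squared mean curvature is a continuous function of the latitude. The two poles
  contribute arbitrary values, which do not disturb measurability.\<close>
lemma mean_curvature_measurable:
  "(\<lambda>p. indicator (sphere 0 1) p * (mean_curvature f p)\<^sup>2) \<in> borel_measurable borel"
proof -
  define Q where "Q s = (if s = 0 then (mean_curvature f (\<Phi> (0, 0)))\<^sup>2 else
     if s = 1 then (mean_curvature f (\<Phi> (1, 0)))\<^sup>2 else indicator {0<..<1} s *\<^sub>R squared_mean_curvature s)" for s
  have [measurable]: "(\<lambda>s. indicator {0<..<1} s *\<^sub>R squared_mean_curvature s) \<in> borel_measurable borel"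
    by (rule borel_measurable_continuous_on_indicator[OF _ continuous_on_squared_mean_curvature]) simp
  have [measurable]: "Q \<in> borel_measurable borel"
    unfolding Q_def by measurable
  have [measurable]: "(\<lambda>p. indicator (sphere 0 1) p *\<^sub>R latitude p) \<in> borel_measurable borel"
    by (rule borel_measurable_continuous_on_indicator[OF _ continuous_on_latitude]) simp
  have [measurable]: "sphere (0 :: real^3) 1 \<in> sets borel" by simp
  have "(mean_curvature f p)\<^sup>2 = Q (indicator (sphere 0 1) p *\<^sub>R latitude p)" if "p \<in> sphere 0 1" for p
  proof -
    have "norm p = 1" using that by simp
    then obtain t \<phi> where t: "t \<in> {0..1}" and p: "p = \<Phi> (t, \<phi>)"
      by (rule polar_surj)
    have lat: "indicator (sphere 0 1) p *\<^sub>R latitude p = t"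
      using that t by (simp add: p latitude_polar)
    show ?thesis
    proof (cases "t = 0 \<or> t = 1")
      case True
      then have "p = \<Phi> (t, 0)" unfolding p using polar_eq_iff[OF t t] by blast
      then show ?thesis unfolding lat using True by (auto simp: Q_def)
    next
      case False
      then show ?thesis
        unfolding lat using t mean_curvature_revolution[of t \<phi>]
        by (simp add: Q_def p squared_mean_curvature_def)
    qed
  qed
  then have eq: "(\<lambda>p. indicator (sphere 0 1) p * (mean_curvature f p)\<^sup>2)
      = (\<lambda>p. indicator (sphere 0 1) p * Q (indicator (sphere 0 1) p *\<^sub>R latitude p))"
    by (auto simp: fun_eq_iff indicator_def)
  show ?thesis unfolding eq by measurable
qed

lemma normal_vec_measurable: "(\<lambda>p. norm (normal_vec f p)) \<in> borel_measurable borel"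
proof -
  have "(\<lambda>p. indicator (- {0}) p *\<^sub>R norm (normal_vec f p)) \<in> borel_measurable borel"
    by (rule borel_measurable_continuous_on_indicator)
       (auto intro!: continuous_on_norm continuous_on_normal_vec)
  then have "(\<lambda>p. if p = 0 then norm (normal_vec f 0)
      else indicator (- {0}) p *\<^sub>R norm (normal_vec f p)) \<in> borel_measurable borel"
    by measurable
  moreover have "(\<lambda>p. if p = 0 then norm (normal_vec f 0)
      else indicator (- {0}) p *\<^sub>R norm (normal_vec f p)) = (\<lambda>p. norm (normal_vec f p))"
    by (auto simp: fun_eq_iff)
  ultimately show ?thesis by simp
qed

lemma willmore_lborel:
  "willmore f = (LINT x|lborel. 3 * indicator (ball 0 1) x * (norm (normal_vec f (sgn x))
      * (indicator (sphere 0 1) (sgn x) * (mean_curvature f (sgn x))\<^sup>2)))"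
proof -
  note [measurable] = mean_curvature_measurable normal_vec_measurable
  have [measurable]: "ball (0 :: real^3) 1 \<in> sets borel" by simp
  have "willmore f = (LINT p|induced_area f. indicator (sphere 0 1) p * (mean_curvature f p)\<^sup>2)"
    by (simp add: willmore_def set_lebesgue_integral_def)
  also have "\<dots> = (LINT p|sphere_area. norm (normal_vec f p)
      *\<^sub>R (indicator (sphere 0 1) p * (mean_curvature f p)\<^sup>2))"
    unfolding induced_area_def by (rule integral_density) (auto simp: sphere_area_def)
  also have "\<dots> = (LINT x|density lborel (\<lambda>x. 3 * indicator (ball 0 1) x). norm (normal_vec f (sgn x))
      *\<^sub>R (indicator (sphere 0 1) (sgn x) * (mean_curvature f (sgn x))\<^sup>2))"
    unfolding sphere_area_def by (rule integral_distr) auto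
  also have "(\<lambda>x::real^3. 3 * indicator (ball 0 1) x) = (\<lambda>x. ennreal (3 * indicator (ball 0 1) x))"
    by (auto simp: fun_eq_iff indicator_def)
  also have "(LINT x|density lborel (\<lambda>x. ennreal (3 * indicator (ball 0 1) x)). norm (normal_vec f (sgn x))
      *\<^sub>R (indicator (sphere 0 1) (sgn x) * (mean_curvature f (sgn x))\<^sup>2))
    = (LINT x|lborel. (3 * indicator (ball 0 1) x) *\<^sub>R (norm (normal_vec f (sgn x))
      *\<^sub>R (indicator (sphere 0 1) (sgn x) * (mean_curvature f (sgn x))\<^sup>2)))"
    by (rule integral_density) auto
  finally show ?thesis by simp
qed

text \<open>In cone coordinates the integrand splits into the factors \<open>3 s\<^sup>2\<close>, \<open>J t / 4\<close> and \<open>1\<close>, whose integrals over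
  their intervals are \<open>1\<close>, \<open>(\<integral> J) / 4\<close> and \<open>2 \<pi>\<close>.\<close>
lemma willmore_revolution:
  assumes J: "continuous_on {0..1} J"
    "\<And>t. t \<in> {0<..<1} \<Longrightarrow> J t = (r t * turning_rate t + h' t)\<^sup>2 / (r t * speed t)"
  shows "willmore f = pi / 2 * integral {0..1} J"
proof -
  define u where "u x = 3 * (norm (normal_vec f (sgn x)) * (mean_curvature f (sgn x))\<^sup>2)" for x
  define k1 :: "real \<Rightarrow> real" where "k1 x = indicator {0<..<1} x * (3 * x\<^sup>2)" for x
  define k2 where "k2 x = indicator {0<..<1} x * (J x / 4)" for x
  define k3 :: "real \<Rightarrow> real" where "k3 x = indicator {0..<2 * pi} x" for x
  have J_nonneg: "0 \<le> J t" if "t \<in> {0<..<1}" for t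
    using that r_pos speed_pos by (simp add: J(2) less_imp_le)
  have J_int: "(J has_integral integral {0..1} J) {0<..<1}"
    using integrable_integral[OF integrable_continuous_interval[OF J(1)]]
    by (simp add: has_integral_Icc_iff_Ioo)
  have I_nonneg: "0 \<le> integral {0..1} J" by (rule has_integral_nonneg[OF J_int J_nonneg])
  have transformed: "\<bar>det (matrix (cone_derivative y))\<bar> * u (cone_map y) = k1 (y $ 1) * k2 (y $ 2) * k3 (y $ 3)"
    if y: "y \<in> cone_domain" for y
  proof -
    let ?t = "y $ 2" and ?\<phi> = "y $ 3"
    have t: "?t \<in> {0<..<1}" using y by (simp add: cone_domain_def)
    have pos: "0 < r ?t" "0 < speed ?t" using t r_pos speed_pos by auto
    have "\<bar>det (matrix (cone_derivative y))\<bar> * u (cone_map y)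
        = 3 * (y $ 1)\<^sup>2 * ((\<bar>jac ?t ?\<phi>\<bar> * norm (normal_vec f (\<Phi> (?t, ?\<phi>)))) * (mean_curvature f (\<Phi> (?t, ?\<phi>)))\<^sup>2)"
      by (simp add: det_cone_derivative u_def sgn_cone_map[OF y] abs_mult)
    also have "\<dots> = 3 * (y $ 1)\<^sup>2 * ((r ?t * speed ?t) *
        ((r ?t * turning_rate ?t + h' ?t) / (2 * (r ?t * speed ?t)))\<^sup>2)"
      unfolding jac_norm_normal_vec[OF t] mean_curvature_revolution[OF t] ..
    also have "(r ?t * speed ?t) * ((r ?t * turning_rate ?t + h' ?t) / (2 * (r ?t * speed ?t)))\<^sup>2 = J ?t / 4"
    proof -
      have "m * (a / (2 * m))\<^sup>2 = a\<^sup>2 / m / 4" if "m \<noteq> 0" for a m :: real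
        using that by (simp add: power2_eq_square)
      then show ?thesis unfolding J(2)[OF t] using pos by simp
    qed
    finally show ?thesis using y by (simp add: k1_def k2_def k3_def cone_domain_def)
  qed
  have "((\<lambda>y. k1 (y $ 1) * k2 (y $ 2) * k3 (y $ 3)) has_integral pi / 2 * integral {0..1} J) (UNIV :: (real^3) set)"
  proof (rule nn_integral_has_integral)
    have k1: "k1 \<in> borel_measurable borel" unfolding k1_def by measurable
    have "continuous_on {0<..<1} (\<lambda>x. J x / 4)"
      using J(1) by (intro continuous_intros) (auto elim: continuous_on_subset)
    from borel_measurable_continuous_on_indicator[OF _ this]
    have k2: "k2 \<in> borel_measurable borel" unfolding k2_def by simp
    have k3: "k3 \<in> borel_measurable borel" unfolding k3_def by measurable
    have nn: "0 \<le> k1 x" "0 \<le> k2 x" "0 \<le> k3 x" for x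
      using J_nonneg by (auto simp: k1_def k2_def k3_def indicator_def)
    note [measurable] = k1 k2 k3
    have "(\<lambda>y::real^3. y $ i) \<in> borel_measurable borel" for i
      by (intro borel_measurable_continuous_onI continuous_intros)
    note [measurable] = this
    show "(\<lambda>y::real^3. k1 (y $ 1) * k2 (y $ 2) * k3 (y $ 3)) \<in> borel_measurable borel"
      by measurable
    show "0 \<le> k1 (y $ 1) * k2 (y $ 2) * k3 (y $ 3)" for y :: "real^3" using nn by simp
    show "0 \<le> pi / 2 * integral {0..1} J" using I_nonneg by simp
    have "((\<lambda>x::real. x ^ 3) has_real_derivative 3 * x\<^sup>2) (at x within {0..1})" for x
      by (auto intro!: derivative_eq_intros)
    then have "((\<lambda>x::real. 3 * x\<^sup>2) has_integral 1 ^ 3 - 0 ^ 3) {0..1}"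
      by (intro fundamental_theorem_of_calculus) (auto simp: has_real_derivative_iff_has_vector_derivative)
    then have "((\<lambda>x::real. 3 * x\<^sup>2) has_integral 1) {0<..<1}"
      by (simp add: has_integral_Icc_iff_Ioo)
    then have i1: "(\<integral>\<^sup>+x. ennreal (k1 x) \<partial>lborel) = ennreal 1"
      using nn_integral_has_integral_lebesgue[of "{0<..<1}" "\<lambda>x::real. 3 * x\<^sup>2" 1]
      by (simp add: k1_def)
    have "((\<lambda>x. J x / 4) has_integral integral {0..1} J / 4) {0<..<1}"
      using has_integral_divide[OF J_int] .
    then have i2: "(\<integral>\<^sup>+x. ennreal (k2 x) \<partial>lborel) = ennreal (integral {0..1} J / 4)"
      using nn_integral_has_integral_lebesgue[of "{0<..<1}" "\<lambda>x. J x / 4"] J_nonneg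
      by (simp add: k2_def)
    have i3: "(\<integral>\<^sup>+x. ennreal (k3 x) \<partial>lborel) = ennreal (2 * pi)"
      by (simp add: k3_def ennreal_indicator)
    show "(\<integral>\<^sup>+y. ennreal (k1 (y $ 1) * k2 (y $ 2) * k3 (y $ 3)) \<partial>(lborel :: (real^3) measure))
        = ennreal (pi / 2 * integral {0..1} J)"
      unfolding nn_integral_lborel_real3[OF k1 k2 k3 nn] i1 i2 i3
      using I_nonneg by (simp add: ennreal_mult[symmetric])
  qed
  then have "((\<lambda>y. if y \<in> cone_domain then k1 (y $ 1) * k2 (y $ 2) * k3 (y $ 3) else 0)
      has_integral pi / 2 * integral {0..1} J) UNIV"
    by (rule has_integral_eq[rotated])
       (auto simp: k1_def k2_def k3_def cone_domain_def indicator_def)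
  then have "((\<lambda>y. k1 (y $ 1) * k2 (y $ 2) * k3 (y $ 3)) has_integral pi / 2 * integral {0..1} J) cone_domain"
    by (simp only: has_integral_restrict_UNIV)
  then have "((\<lambda>y. \<bar>det (matrix (cone_derivative y))\<bar> * u (cone_map y)) has_integral
      pi / 2 * integral {0..1} J) cone_domain"
    by (rule has_integral_eq[rotated]) (simp add: transformed)
  then have "(u has_integral pi / 2 * integral {0..1} J) (cone_map ` cone_domain)"
    by (intro has_integral_change_of_variables_nonneg[OF _ cone_map_has_derivative inj_on_cone_map])
       (use sets_cone_domain in \<open>auto simp: u_def\<close>)
  then have ball: "(u has_integral pi / 2 * integral {0..1} J) (ball 0 1)"
  proof (rule has_integral_spike_set_eq[THEN iffD1, rotated 2])
    show "negligible {x \<in> cone_map ` cone_domain - ball 0 1. u x \<noteq> 0}"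
      using cone_map_image(1) by (intro empty_imp_negligible) blast
    show "negligible {x \<in> ball 0 1 - cone_map ` cone_domain. u x \<noteq> 0}"
      by (rule negligible_subset[OF cone_map_image(2)]) blast
  qed
  define V where "V x = 3 * indicator (ball 0 1) x * (norm (normal_vec f (sgn x))
      * (indicator (sphere 0 1) (sgn x) * (mean_curvature f (sgn x))\<^sup>2))" for x
  have "((\<lambda>x. if x \<in> ball 0 1 then u x else 0) has_integral pi / 2 * integral {0..1} J) UNIV"
    using ball by (simp only: has_integral_restrict_UNIV)
  then have V_int: "(V has_integral pi / 2 * integral {0..1} J) UNIV"
    by (rule has_integral_spike[OF negligible_sing[of 0], rotated])
       (auto simp: V_def u_def norm_sgn indicator_def)
  note [measurable] = measurable_compose[OF borel_measurable_sgn mean_curvature_measurable]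
    measurable_compose[OF borel_measurable_sgn normal_vec_measurable]
  have [measurable]: "ball (0 :: real^3) 1 \<in> sets borel" by simp
  have V_meas: "V \<in> borel_measurable borel"
    unfolding V_def by measurable
  have V_nonneg: "0 \<le> V x" for x by (simp add: V_def)
  have "has_bochner_integral lborel V (pi / 2 * integral {0..1} J)"
    by (rule has_bochner_integral_nn_integral)
       (use V_meas V_nonneg I_nonneg nn_integral_has_integral_lborel[OF V_meas V_nonneg V_int] in auto)
  then show ?thesis
    unfolding willmore_lborel V_def by (rule has_bochner_integral_integral_eq)
qed

end

section \<open>Recognizing round spheres\<close>

lemma sphere_extension_continuous:
  fixes \<psi> :: "real^3 \<Rightarrow> 'b::real_normed_vector"
  assumes "continuous_on (sphere 0 1) \<psi>"
  shows "continuous_on (- {0}) (\<lambda>x. norm x *\<^sub>R \<psi> (sgn x))"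
proof -
  have "continuous_on (- {0}) (\<lambda>x::real^3. \<psi> (sgn x))"
    by (rule continuous_on_compose2[OF assms])
       (auto intro!: continuous_on_sgn continuous_on_id simp: norm_sgn split: if_splits)
  then show ?thesis by (intro continuous_intros)
qed

text \<open>The extension of \<open>\<psi>\<close> is homogeneous of degree \<open>0\<close>, so that its derivative is homogeneous of degree \<open>-1\<close>.
  This carries injectivity of the derivative from the sphere to all nonzero points.\<close>
lemma sphere_diff_scale:
  assumes "smooth_on (sphere 0 1) \<psi>" "x \<noteq> 0"
  shows "sphere_diff \<psi> x w = inverse (norm x) *\<^sub>R sphere_diff \<psi> (sgn x) w"
proof -
  interpret smooth_sphere_map \<psi> using assms(1) by unfold_locales
  let ?c = "inverse (norm x)"
  have c: "0 < ?c" using assms(2) by simp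
  have s: "?c *\<^sub>R x = sgn x" by (simp add: sgn_div_norm)
  have "sgn x \<noteq> 0" using assms(2) by (simp add: sgn_zero_iff)
  then have F: "((\<lambda>x. \<psi> (sgn x)) has_derivative sphere_diff \<psi> (sgn x)) (at (?c *\<^sub>R x))"
    unfolding s by (rule has_derivative)
  have "((\<lambda>y. ?c *\<^sub>R y) has_derivative (\<lambda>y. ?c *\<^sub>R y)) (at x)"
    by (intro bounded_linear_imp_has_derivative bounded_linear_scaleR_right)
  from has_derivative_compose[OF this F]
  have "((\<lambda>y. \<psi> (sgn (?c *\<^sub>R y))) has_derivative (\<lambda>y. sphere_diff \<psi> (sgn x) (?c *\<^sub>R y))) (at x)" .
  moreover have "sgn (?c *\<^sub>R y) = sgn y" for y :: "real^3"
    using c by (simp add: sgn_scaleR)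
  ultimately have "((\<lambda>y. \<psi> (sgn y)) has_derivative (\<lambda>y. sphere_diff \<psi> (sgn x) (?c *\<^sub>R y))) (at x)"
    by simp
  then have "sphere_diff \<psi> x = (\<lambda>y. sphere_diff \<psi> (sgn x) (?c *\<^sub>R y))"
    using has_derivative[OF assms(2)] by (intro has_derivative_unique) auto
  then have "sphere_diff \<psi> x w = sphere_diff \<psi> (sgn x) (?c *\<^sub>R w)" by (rule fun_cong)
  also have "\<dots> = ?c *\<^sub>R sphere_diff \<psi> (sgn x) w"
    by (rule linear_scale[OF linear[OF \<open>sgn x \<noteq> 0\<close>]])
  finally show ?thesis .
qed

text \<open>Both \<open>\<psi>\<close> and its inverse are extended to the punctured space as maps of degree \<open>1\<close>. The extensions are
  inverse to each other, and the derivative of the first one is invertible: its radial part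
  is mapped to the direction \<open>\<psi>\<close>, its tangential part injectively to the orthogonal complement. The inverse function
  lemma applies to them.\<close>
lemma immersed_homeomorphism_imp_diffeo:
  assumes imm: "sphere_immersion \<psi>" and hom: "homeomorphism (sphere 0 1) (sphere 0 1) \<psi> \<psi>'"
  shows "sphere_diffeo \<psi>"
proof -
  have smooth: "smooth_on (sphere 0 1) \<psi>" using imm by (simp add: sphere_immersion_def)
  then interpret smooth_sphere_map \<psi> by unfold_locales
  define e where "e x = norm x *\<^sub>R \<psi> (sgn x)" for x
  define e' where "e' x = norm x *\<^sub>R \<psi>' (sgn x)" for x
  have \<psi>_norm: "norm (\<psi> y) = 1" and \<psi>'_norm: "norm (\<psi>' y) = 1" and inv: "\<psi> (\<psi>' y) = y"
    if "norm y = 1" for y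
  proof -
    have y: "y \<in> sphere 0 1" using that by simp
    then have "\<psi> y \<in> sphere 0 1" "\<psi>' y \<in> sphere 0 1"
      using hom unfolding homeomorphism_def by blast+
    then show "norm (\<psi> y) = 1" "norm (\<psi>' y) = 1" by simp_all
    show "\<psi> (\<psi>' y) = y" using hom y unfolding homeomorphism_def by blast
  qed
  have sgn_norm: "norm (sgn x) = 1" if "x \<noteq> 0" for x :: "real^3" using that by (simp add: norm_sgn)
  have e_Ck: "Ck_on k (- {0}) e" for k
    unfolding e_def by (intro Ck_on_scaleR open_nonzero Ck_on_norm sphere_extension_Ck_on smooth)
  have "Ck_on k (- {0}) e'" for k
  proof (rule Ck_on_inverse_function[OF open_nonzero open_nonzero e_Ck])
    show "continuous_on (- {0}) e'"
      unfolding e'_def using hom by (intro sphere_extension_continuous) (simp add: homeomorphism_def)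
    show "e' ` (- {0}) \<subseteq> - {0}"
    proof
      fix y assume "y \<in> e' ` (- {0})"
      then obtain x where "x \<noteq> 0" "y = e' x" by auto
      then have "norm y = norm x" by (simp add: e'_def \<psi>'_norm sgn_norm)
      then show "y \<in> - {0}" using \<open>x \<noteq> 0\<close> by auto
    qed
    show "e (e' y) = y" if "y \<in> - {0}" for y
    proof -
      have y: "y \<noteq> 0" using that by simp
      have n: "norm (\<psi>' (sgn y)) = 1" by (rule \<psi>'_norm[OF sgn_norm[OF y]])
      then have "norm (e' y) = norm y" "sgn (e' y) = \<psi>' (sgn y)"
        using y by (simp_all add: e'_def sgn_scaleR sgn_div_norm[of "\<psi>' _"])
      then have "e (e' y) = norm y *\<^sub>R sgn y" by (simp add: e_def inv[OF sgn_norm[OF y]])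
      then show ?thesis using y by (simp add: sgn_div_norm)
    qed
    show "inj (frechet_derivative e (at x))" if "x \<in> - {0}" for x
    proof -
      have x: "x \<noteq> 0" using that by simp
      have "(norm has_derivative (\<lambda>w. sgn x \<bullet> w)) (at x)"
        using has_derivative_norm[OF x] by (simp add: inner_commute)
      from has_derivative_scaleR[OF this has_derivative[OF x]]
      have e': "(e has_derivative (\<lambda>w. norm x *\<^sub>R sphere_diff \<psi> x w + (sgn x \<bullet> w) *\<^sub>R \<psi> (sgn x))) (at x)"
        unfolding e_def[abs_def] .
      note D = frechet_derivative_at[OF e', symmetric]
      have orth: "\<psi> (sgn x) \<bullet> sphere_diff \<psi> x w = 0" for w
      proof -
        have "((\<lambda>x. \<psi> (sgn x) \<bullet> \<psi> (sgn x)) has_derivative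
            (\<lambda>w. \<psi> (sgn x) \<bullet> sphere_diff \<psi> x w + sphere_diff \<psi> x w \<bullet> \<psi> (sgn x))) (at x)"
          by (rule has_derivative_inner[OF has_derivative[OF x] has_derivative[OF x]])
        then have "((\<lambda>x. 1 :: real) has_derivative
            (\<lambda>w. \<psi> (sgn x) \<bullet> sphere_diff \<psi> x w + sphere_diff \<psi> x w \<bullet> \<psi> (sgn x))) (at x)"
          by (rule has_derivative_transform_within_open[OF _ open_nonzero])
             (use x \<psi>_norm sgn_norm in \<open>auto simp: norm_eq_1\<close>)
        then have "(\<lambda>w. \<psi> (sgn x) \<bullet> sphere_diff \<psi> x w + sphere_diff \<psi> x w \<bullet> \<psi> (sgn x)) = (\<lambda>w. 0)"
          by (rule has_derivative_unique) (rule has_derivative_const)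
        from fun_cong[OF this, of w] show ?thesis by (simp add: inner_commute)
      qed
      have "w = 0" if w: "norm x *\<^sub>R sphere_diff \<psi> x w + (sgn x \<bullet> w) *\<^sub>R \<psi> (sgn x) = 0" for w
      proof -
        have "\<psi> (sgn x) \<bullet> (norm x *\<^sub>R sphere_diff \<psi> x w + (sgn x \<bullet> w) *\<^sub>R \<psi> (sgn x)) = 0"
          unfolding w by simp
        moreover have "\<psi> (sgn x) \<bullet> \<psi> (sgn x) = 1"
          using \<psi>_norm[OF sgn_norm[OF x]] by (simp add: norm_eq_1)
        ultimately have tan: "sgn x \<bullet> w = 0" by (simp add: inner_add_right orth)
        then have "sphere_diff \<psi> x w = 0" using w x by simp
        then have "sphere_diff \<psi> (sgn x) w = 0"
          using sphere_diff_scale[OF smooth x, of w] x by simp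
        moreover have "sphere_diff \<psi> (sgn x) 0 = 0"
          using x by (intro linear_0 linear) (simp add: sgn_zero_iff)
        moreover have "inj_on (sphere_diff \<psi> (sgn x)) (sphere_tangent (sgn x))"
          using imm sgn_norm[OF x] by (simp add: sphere_immersion_def)
        moreover have "w \<in> sphere_tangent (sgn x)" "0 \<in> sphere_tangent (sgn x)"
          using tan by (simp_all add: sphere_tangent_def inner_commute)
        ultimately show "w = 0" by (metis inj_onD)
      qed
      then show ?thesis
        unfolding D using linear_injective_0[OF has_derivative_linear[OF e']] by blast
    qed
  qed
  then have "smooth_on (sphere 0 1) \<psi>'"
    unfolding smooth_on_def
    by (intro exI[of _ "- {0}"] exI[of _ e'] conjI allI ballI open_nonzero)
       (auto simp: e'_def sgn_div_norm)
  then show ?thesis using hom smooth by (auto simp: sphere_diffeo_def)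
qed

lemma immersion_rescaled:
  assumes "sphere_immersion f" "R \<noteq> 0"
  shows "sphere_immersion (\<lambda>p. inverse R *\<^sub>R (f p - a))"
proof -
  have smooth: "smooth_on (sphere 0 1) f" using assms(1) by (simp add: sphere_immersion_def)
  then interpret smooth_sphere_map f by unfold_locales
  have D: "sphere_diff (\<lambda>p. inverse R *\<^sub>R (f p - a)) p v = inverse R *\<^sub>R sphere_diff f p v"
    if "p \<noteq> 0" for p v
  proof -
    have "((\<lambda>x. inverse R *\<^sub>R (f (sgn x) - a)) has_derivative (\<lambda>v. inverse R *\<^sub>R (sphere_diff f p v - 0))) (at p)"
      by (intro has_derivative_scaleR_right has_derivative_diff has_derivative[OF that] has_derivative_const)
    then show ?thesis
      unfolding sphere_diff_def[of "\<lambda>p. inverse R *\<^sub>R (f p - a)"]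
      by (simp add: frechet_derivative_at[symmetric])
  qed
  have Ck: "Ck_on k (- {0}) (\<lambda>x. inverse R *\<^sub>R (f (sgn x) + (- a)))" for k
    by (intro Ck_on_scaleR Ck_on_add Ck_on_const sphere_extension_Ck_on open_nonzero smooth)
  have "smooth_on (sphere 0 1) (\<lambda>p. inverse R *\<^sub>R (f p - a))"
    unfolding smooth_on_def
    by (intro exI[of _ "- {0}"] exI[of _ "\<lambda>x. inverse R *\<^sub>R (f (sgn x) + (- a))"] conjI allI ballI open_nonzero Ck)
       (auto simp: sgn_div_norm)
  moreover have "inj_on (sphere_diff (\<lambda>p. inverse R *\<^sub>R (f p - a)) p) (sphere_tangent p)"
    if "p \<in> sphere 0 1" for p
  proof -
    have "p \<noteq> 0" using that by auto
    moreover have "inj_on (sphere_diff f p) (sphere_tangent p)"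
      using assms(1) that by (simp add: sphere_immersion_def)
    ultimately show ?thesis using assms(2) by (auto simp: inj_on_def D)
  qed
  ultimately show ?thesis by (simp add: sphere_immersion_def)
qed

text \<open>After rescaling, \<open>f \<circ> \<Phi>\<close> is the parametrization of the unit sphere by spherical coordinates, with
  \<open>\<alpha>\<close> as the polar angle. Both parametrizations identify the same points, so \<open>f\<close> is bijective
  onto its image. The sign \<open>\<sigma>\<close> distinguishes the two directions in which the
  half circle may be traversed.\<close>
lemma (in polar_parametrized_sphere) semicircle_profile_imp_round:
  assumes imm: "sphere_immersion f" and R: "0 < R" and \<sigma>: "\<sigma> \<in> {-1, 1}"
    and \<alpha>: "continuous_on {0..1} \<alpha>" "strict_mono_on {0..1} \<alpha>" "\<alpha> 0 = 0" "\<alpha> 1 = pi"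
    and f: "\<And>t \<phi>. t \<in> {0..1} \<Longrightarrow> f (\<Phi> (t, \<phi>)) =
      vector [R * sin (\<alpha> t) * cos \<phi>, R * sin (\<alpha> t) * sin \<phi>, b - \<sigma> * R * cos (\<alpha> t)]"
  shows "round_sphere f"
proof -
  define \<psi> where "\<psi> p = inverse R *\<^sub>R (f p - vector [0, 0, b])" for p
  have imm': "sphere_immersion \<psi>"
    unfolding \<psi>_def using imm R by (intro immersion_rescaled) auto
  have \<sigma>2: "\<sigma> * \<sigma> = 1" using \<sigma> by auto
  have \<psi>: "\<psi> (\<Phi> (t, \<phi>)) = vector [sin (\<alpha> t) * cos \<phi>, sin (\<alpha> t) * sin \<phi>, - \<sigma> * cos (\<alpha> t)]"
    if "t \<in> {0..1}" for t \<phi>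
    using R by (simp add: \<psi>_def f[OF that] vec_eq_iff forall_3)
  have mono: "\<alpha> s < \<alpha> t" if "s \<in> {0..1}" "t \<in> {0..1}" "s < t" for s t
    using \<alpha>(2) that by (rule strict_mono_onD)
  have range: "\<alpha> t \<in> {0..pi}" if "t \<in> {0..1}" for t
    using mono[of 0 t] mono[of t 1] that \<alpha>(3,4) by (cases "t = 0"; cases "t = 1") auto
  have inj: "inj_on \<psi> (sphere 0 1)"
  proof (rule inj_onI)
    fix p q assume "p \<in> sphere 0 1" "q \<in> sphere 0 1" and eq: "\<psi> p = \<psi> q"
    then have "norm p = 1" "norm q = 1" by auto
    then obtain t \<phi> t' \<phi>' where t: "t \<in> {0..1}" "t' \<in> {0..1}" and pq: "p = \<Phi> (t, \<phi>)" "q = \<Phi> (t', \<phi>')"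
      using polar_surj by metis
    have c: "sin (\<alpha> t) * cos \<phi> = sin (\<alpha> t') * cos \<phi>'" "sin (\<alpha> t) * sin \<phi> = sin (\<alpha> t') * sin \<phi>'"
      "\<sigma> * cos (\<alpha> t) = \<sigma> * cos (\<alpha> t')"
      using eq unfolding pq \<psi>[OF t(1)] \<psi>[OF t(2)] by (auto simp: vec_eq_iff forall_3)
    have "cos (\<alpha> t) = cos (\<alpha> t')" using c(3) \<sigma> by auto
    moreover have "0 \<le> \<alpha> t" "\<alpha> t \<le> pi" "0 \<le> \<alpha> t'" "\<alpha> t' \<le> pi"
      using range[OF t(1)] range[OF t(2)] by auto
    ultimately have "\<alpha> t = \<alpha> t'" by (metis cos_inj_pi)
    then have tt: "t = t'" using mono[of t t'] mono[of t' t] t by (cases t t' rule: linorder_cases) auto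
    show "p = q"
    proof (cases "t = 0 \<or> t = 1")
      case True
      then show ?thesis unfolding pq using polar_eq_iff[OF t] tt by blast
    next
      case False
      then have "0 < \<alpha> t" "\<alpha> t < pi" using mono[of 0 t] mono[of t 1] t \<alpha>(3,4) by auto
      then have "0 < sin (\<alpha> t)" by (rule sin_gt_zero)
      then have "sin \<phi>' = sin \<phi> \<and> cos \<phi>' = cos \<phi>" using c(1,2) tt by auto
      then obtain k :: int where "\<phi>' = \<phi> + 2 * pi * of_int k"
        unfolding sin_cos_eq_iff by auto
      then show ?thesis unfolding pq using polar_eq_iff[OF t] tt by blast
    qed
  qed
  have surj: "\<psi> ` sphere 0 1 = sphere 0 1"
  proof
    show "\<psi> ` sphere 0 1 \<subseteq> sphere 0 1"
    proof
      fix y assume "y \<in> \<psi> ` sphere 0 1"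
      then obtain p where "norm p = 1" and y: "y = \<psi> p" by auto
      then obtain t \<phi> where t: "t \<in> {0..1}" and p: "p = \<Phi> (t, \<phi>)" using polar_surj by metis
      have "cos (\<alpha> t) * cos (\<alpha> t) = 1 - sin (\<alpha> t) * sin (\<alpha> t)" "cos \<phi> * cos \<phi> = 1 - sin \<phi> * sin \<phi>"
        using sin_cos_squared_add3 by (simp_all add: algebra_simps)
      then have "y \<bullet> y = 1"
        unfolding y p \<psi>[OF t] inner_vec_def sum_3 using \<sigma>2 by simp algebra
      then show "y \<in> sphere 0 1" by (simp add: norm_eq_1)
    qed
    show "sphere 0 1 \<subseteq> \<psi> ` sphere 0 1"
    proof
      fix y :: "real^3" assume "y \<in> sphere 0 1"
      then have "y \<bullet> y = 1" by (simp add: norm_eq_1)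
      then have y: "(y $ 1)\<^sup>2 + (y $ 2)\<^sup>2 + (y $ 3)\<^sup>2 = 1"
        by (simp add: inner_vec_def sum_3 power2_eq_square)
      then have "(y $ 3)\<^sup>2 \<le> 1" using zero_le_power2[of "y $ 1"] zero_le_power2[of "y $ 2"] by linarith
      then have "\<bar>- \<sigma> * y $ 3\<bar> \<le> 1" using \<sigma> by (auto simp: abs_square_le_1)
      then have z: "cos (arccos (- \<sigma> * y $ 3)) = - \<sigma> * y $ 3" "0 \<le> arccos (- \<sigma> * y $ 3)"
          "arccos (- \<sigma> * y $ 3) \<le> pi"
        using cos_arccos_abs arccos_bounded by (auto simp: abs_le_iff)
      obtain t where t: "t \<in> {0..1}" "\<alpha> t = arccos (- \<sigma> * y $ 3)"
        using IVT'[of \<alpha> 0 "arccos (- \<sigma> * y $ 3)" 1] \<alpha> z by auto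
      have cos: "cos (\<alpha> t) = - \<sigma> * y $ 3" using t z by simp
      have "(cos (\<alpha> t))\<^sup>2 = (y $ 3)\<^sup>2"
        unfolding cos using \<sigma>2 by (simp add: power2_eq_square algebra_simps)
      then have s: "(sin (\<alpha> t))\<^sup>2 = (y $ 1)\<^sup>2 + (y $ 2)\<^sup>2"
        using y sin_cos_squared_add[of "\<alpha> t"] by linarith
      obtain \<phi> where \<phi>: "y $ 1 = sin (\<alpha> t) * cos \<phi>" "y $ 2 = sin (\<alpha> t) * sin \<phi>"
      proof (cases "sin (\<alpha> t) = 0")
        case True
        then have "y $ 1 = 0" "y $ 2 = 0" using s by (auto simp: sum_power2_eq_zero_iff)
        then show ?thesis using True that by simp
      next
        case False
        then have "(y $ 1 / sin (\<alpha> t))\<^sup>2 + (y $ 2 / sin (\<alpha> t))\<^sup>2 = 1"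
          unfolding power_divide add_divide_distrib[symmetric] s[symmetric] using False by simp
        then obtain \<phi> where "y $ 1 / sin (\<alpha> t) = cos \<phi>" "y $ 2 / sin (\<alpha> t) = sin \<phi>"
          using sincos_total_2pi by metis
        then show ?thesis using False that by (simp add: field_simps)
      qed
      have "y = \<psi> (\<Phi> (t, \<phi>))"
        unfolding \<psi>[OF t(1)] using \<phi> cos \<sigma>2 by (simp add: vec_eq_iff forall_3)
      then show "y \<in> \<psi> ` sphere 0 1" using polar_on_sphere[OF t(1)] by auto
    qed
  qed
  have cont: "continuous_on (sphere 0 1) \<psi>"
  proof -
    have "Ck_on 0 (- {0}) (\<lambda>x. \<psi> (sgn x))"
      using imm' by (intro sphere_extension_Ck_on) (simp add: sphere_immersion_def)
    then have "continuous_on (sphere 0 1) (\<lambda>x. \<psi> (sgn x))"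
      by (auto elim: continuous_on_subset)
    then show ?thesis by (rule continuous_on_eq) (simp add: sgn_div_norm)
  qed
  obtain \<psi>' where "homeomorphism (sphere 0 1) (sphere 0 1) \<psi> \<psi>'"
    using homeomorphism_compact[OF compact_sphere cont surj inj] by blast
  then have "sphere_diffeo \<psi>" by (rule immersed_homeomorphism_imp_diffeo[OF imm'])
  moreover have "f p = vector [0, 0, b] + R *\<^sub>R \<psi> p" for p
    using R by (simp add: \<psi>_def)
  ultimately show ?thesis unfolding round_sphere_def using R by blast
qed

section \<open>The energy inequality on the profile\<close>

text \<open>A continuous lift of a differentiable angle is differentiable: near \<open>t\<close> the increment of \<open>\<theta>\<close> lies in the range of
  \<open>arcsin\<close>, and its sine is expressed by \<open>C\<close> and \<open>S\<close> through the addition theorem.\<close>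
lemma angle_has_derivative:
  fixes \<theta> C S :: "real \<Rightarrow> real"
  assumes cont: "isCont \<theta> t"
    and ev: "eventually (\<lambda>x. cos (\<theta> x) = C x \<and> sin (\<theta> x) = S x) (nhds t)"
    and C: "(C has_real_derivative C') (at t)" and S: "(S has_real_derivative S') (at t)"
  shows "(\<theta> has_real_derivative C t * S' - S t * C') (at t)"
proof -
  have t: "cos (\<theta> t) = C t" "sin (\<theta> t) = S t"
    using eventually_nhds_x_imp_x[OF ev] by auto
  have "eventually (\<lambda>x. dist (\<theta> x) (\<theta> t) < pi / 2) (nhds t)"
    using cont tendstoD[of \<theta> "\<theta> t" "nhds t" "pi/2"]
    by (simp add: continuous_within tendsto_nhds_iff)
  with ev have eq: "eventually (\<lambda>x. \<theta> x = \<theta> t + arcsin (S x * C t - C x * S t)) (nhds t)"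
  proof eventually_elim
    case (elim x)
    have "S x * C t - C x * S t = sin (\<theta> x - \<theta> t)"
      using elim t by (simp add: sin_diff)
    moreover have "- (pi / 2) \<le> \<theta> x - \<theta> t" "\<theta> x - \<theta> t \<le> pi / 2"
      using elim by (auto simp: dist_real_def abs_if split: if_splits)
    ultimately show ?case by (simp add: arcsin_sin)
  qed
  have "(arcsin has_real_derivative 1) (at (S t * C t - C t * S t))"
    using DERIV_arcsin[of 0] by simp
  moreover have "((\<lambda>x. S x * C t - C x * S t) has_real_derivative S' * C t - C' * S t) (at t)"
    by (rule DERIV_diff[OF DERIV_cmult_right[OF S] DERIV_cmult_right[OF C]])
  ultimately have "((\<lambda>x. arcsin (S x * C t - C x * S t)) has_real_derivative
      1 * (S' * C t - C' * S t)) (at t)"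
    by (rule DERIV_chain2)
  from DERIV_add[OF DERIV_const this, of "\<theta> t"]
  have "((\<lambda>x. \<theta> t + arcsin (S x * C t - C x * S t)) has_real_derivative C t * S' - S t * C') (at t)"
    by (simp add: algebra_simps)
  then show ?thesis
    by (subst DERIV_cong_ev[OF refl eq refl])
qed

lemma zero_derivative_imp_eq:
  fixes f :: "real \<Rightarrow> real"
  assumes "convex S" "\<And>x. x \<in> S \<Longrightarrow> (f has_real_derivative 0) (at x)" "a \<in> S" "b \<in> S"
  shows "f a = f b"
proof -
  have "\<exists>c. \<forall>x\<in>S. f x = c"
    using has_field_derivative_zero_constant[OF assms(1) has_field_derivative_at_within[OF assms(2)]] .
  then show ?thesis using assms(3,4) by metis
qed

text \<open>Each positive arch of the sine increases \<open>P\<close> by \<open>2\<close>, each negative one leaves it unchanged. An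
  antiderivative on a bounded interval suffices for angle functions on \<open>[0,1]\<close>.\<close>
lemma positive_sine_antiderivative:
  obtains P :: "real \<Rightarrow> real"
  where "\<And>x. \<bar>x\<bar> < M \<Longrightarrow> (P has_real_derivative max (sin x) 0) (at x)"
    and "\<And>k::nat. 2 * pi * k + pi < M \<Longrightarrow> P (2 * pi * k + pi) - P 0 = 2 * (real k + 1)"
proof -
  have "continuous_on {- M..M} (\<lambda>x. max (sin x) 0)"
    by (intro continuous_intros)
  then obtain P where P: "\<And>x. x \<in> {- M..M} \<Longrightarrow>
      (P has_vector_derivative max (sin x) 0) (at x within {- M..M})"
    using antiderivative_continuous by blast
  have D: "(P has_real_derivative max (sin x) 0) (at x)" if "\<bar>x\<bar> < M" for x
  proof -
    have "x \<in> interior {- M..M}" using that by (auto simp: abs_less_iff)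
    then show ?thesis
      using P[of x] that at_within_interior[of x "{- M..M}"]
      by (simp add: has_real_derivative_iff_has_vector_derivative abs_less_iff)
  qed
  have period: "sin (2 * pi * real k) = 0" "cos (2 * pi * real k) = 1" for k :: nat
    using sin_int_2pin[of "int k"] cos_int_2pin[of "int k"] by simp_all
  have up: "P (2 * pi * k + pi) - P (2 * pi * k) = 2" if "2 * pi * k + pi < M" for k :: nat
  proof -
    let ?a = "2 * pi * real k"
    have "((\<lambda>x. P x + cos x) has_real_derivative 0) (at x)"
      if "?a \<le> x" "x \<le> ?a + pi" for x
    proof -
      have "0 \<le> sin (x - ?a)" using that by (intro sin_ge_zero) auto
      also have "sin (x - ?a) = sin x" by (simp add: sin_diff period)
      finally have "max (sin x) 0 = sin x" by simp
      moreover have "0 \<le> ?a" by simp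
      then have "\<bar>x\<bar> < M" using that \<open>?a + pi < M\<close> by linarith
      ultimately show ?thesis using D[of x] by (auto intro!: derivative_eq_intros)
    qed
    then have "P ?a + cos ?a = P (?a + pi) + cos (?a + pi)"
      by (intro zero_derivative_imp_eq[of "{?a..?a + pi}" "\<lambda>x. P x + cos x"]) auto
    then show ?thesis by (simp add: period)
  qed
  have down: "P (2 * pi * Suc k) = P (2 * pi * k + pi)" if "2 * pi * Suc k < M" for k :: nat
  proof -
    let ?a = "2 * pi * real k + pi"
    have "(P has_real_derivative 0) (at x)" if "?a \<le> x" "x \<le> ?a + pi" for x
    proof -
      have "0 \<le> sin (x - ?a)" using that by (intro sin_ge_zero) auto
      also have "sin (x - ?a) = - sin x" by (simp add: sin_diff sin_add cos_add period)
      finally have "max (sin x) 0 = 0" by simp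
      moreover have "0 \<le> 2 * pi * real k" "?a + pi < M"
        using \<open>2 * pi * Suc k < M\<close> by (simp_all add: algebra_simps)
      then have "\<bar>x\<bar> < M" using that pi_gt_zero by linarith
      ultimately show ?thesis using D[of x] by simp
    qed
    then have "P ?a = P (?a + pi)"
      by (intro zero_derivative_imp_eq[of "{?a..?a + pi}" P]) auto
    moreover have "?a + pi = 2 * pi * Suc k" by (simp add: algebra_simps)
    ultimately show ?thesis by simp
  qed
  have total: "P (2 * pi * k + pi) - P 0 = 2 * (real k + 1)" if "2 * pi * k + pi < M" for k :: nat
    using that
  proof (induction k)
    case 0
    then show ?case using up[of 0] by simp
  next
    case (Suc k)
    have "2 * pi * k + pi < M" "2 * pi * Suc k < M"
      using Suc.prems pi_gt_zero unfolding of_nat_Suc distrib_left by linarith+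
    then show ?case using Suc.IH up[OF Suc.prems] down[of k] by simp
  qed
  show thesis using that D total by blast
qed

lemma has_integral_nonneg_eq_0:
  fixes f :: "real \<Rightarrow> real"
  assumes f: "(f has_integral 0) {a<..<b}" and cont: "continuous_on {a<..<b} f"
    and nonneg: "\<And>x. x \<in> {a<..<b} \<Longrightarrow> 0 \<le> f x" and x: "x \<in> {a<..<b}"
  shows "f x = 0"
proof -
  define u w where "u = (a + x) / 2" and "w = (x + b) / 2"
  have uw: "a < u" "u < x" "x < w" "w < b" using x by (auto simp: u_def w_def)
  then have sub: "cbox u w \<subseteq> {a<..<b}" by auto
  have c: "continuous_on (cbox u w) f" using cont sub by (rule continuous_on_subset)
  have int: "f integrable_on cbox u w" using c by (rule integrable_continuous)
  have "integral (cbox u w) f \<le> integral {a<..<b} f"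
    using f int sub nonneg by (intro integral_subset_le) auto
  also have "\<dots> = 0" using f by (rule integral_unique)
  finally have "integral (cbox u w) f \<le> 0" .
  moreover have "0 \<le> integral (cbox u w) f"
    using sub nonneg by (intro integral_nonneg[OF int]) auto
  ultimately have "(f has_integral 0) (cbox u w)"
    using int by (simp add: has_integral_integrable_integral)
  from has_integral_0_cbox_imp_0[OF c _ this] show ?thesis
    using sub nonneg uw by (auto simp: box_real)
qed

text \<open>With this function, twice the square of the positive part of \<open>x\<close> can be written as \<open>x \<bar>x\<bar> + x\<^sup>2\<close>, which is
  differentiable everywhere, also at \<open>0\<close>.\<close>
lemma has_real_derivative_self_times_abs:
  "((\<lambda>x::real. x * \<bar>x\<bar>) has_real_derivative 2 * \<bar>x\<bar>) (at x)"
proof (cases x "0 :: real" rule: linorder_cases)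
  case less
  have "eventually (\<lambda>y. y < 0) (nhds x)"    using eventually_nhds_in_open[of "{..<0}" x] less by simp
  then have "eventually (\<lambda>y. y * \<bar>y\<bar> = - (y * y)) (nhds x)"
    by (rule eventually_mono) simp
  moreover have "((\<lambda>y. - (y * y)) has_real_derivative 2 * \<bar>x\<bar>) (at x)"
    using less by (auto intro!: derivative_eq_intros)
  ultimately show ?thesis by (subst DERIV_cong_ev[OF refl _ refl])
next
  case greater
  have "eventually (\<lambda>y. y > 0) (nhds x)"    using eventually_nhds_in_open[of "{0<..}" x] greater by simp
  then have "eventually (\<lambda>y. y * \<bar>y\<bar> = y * y) (nhds x)"
    by (rule eventually_mono) simp
  moreover have "((\<lambda>y. y * y) has_real_derivative 2 * \<bar>x\<bar>) (at x)"
    using greater by (auto intro!: derivative_eq_intros)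
  ultimately show ?thesis by (subst DERIV_cong_ev[OF refl _ refl])
next
  case equal
  have "((\<lambda>h::real. \<bar>h\<bar>) \<longlongrightarrow> \<bar>0\<bar>) (at 0)" by (intro tendsto_intros)
  moreover have "eventually (\<lambda>h::real. \<bar>h\<bar> = h * \<bar>h\<bar> / h) (at 0)"
    by (simp add: eventually_at_filter)
  ultimately have "((\<lambda>h::real. h * \<bar>h\<bar> / h) \<longlongrightarrow> \<bar>0\<bar>) (at 0)"
    by (rule Lim_transform_eventually)
  then show ?thesis using equal by (simp add: has_field_derivative_iff)
qed

lemma square_sum_div_minus:
  fixes r v x s :: real
  assumes "r * v \<noteq> 0"
  shows "(r * x + v * s)\<^sup>2 / (r * v) - 4 * s * x = (r * x - v * s)\<^sup>2 / (r * v)"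
proof -
  have "(r * x + v * s)\<^sup>2 = (r * x - v * s)\<^sup>2 + (4 * s * x) * (r * v)"
    by (simp add: power2_eq_square algebra_simps)
  then show ?thesis using assms by (simp add: add_divide_distrib)
qed

text \<open>The energy density \<open>J\<close> is given as a continuous function up to the ends of the interval, although the formula for it
  is meaningful in the interior only. The angle is normalized such that it starts at \<open>0\<close> and turns
  in the positive direction.\<close>
context
  fixes \<theta> \<theta>' r v J :: "real \<Rightarrow> real" and k :: nat
  assumes \<theta>: "continuous_on {0..1} \<theta>"
    and \<theta>': "\<And>t. t \<in> {0<..<1} \<Longrightarrow> (\<theta> has_real_derivative \<theta>' t) (at t)" "continuous_on {0<..<1} \<theta>'"
    and r: "\<And>t. t \<in> {0<..<1} \<Longrightarrow> (r has_real_derivative v t * cos (\<theta> t)) (at t)"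
      "\<And>t. t \<in> {0<..<1} \<Longrightarrow> 0 < r t"
    and v: "\<And>t. t \<in> {0<..<1} \<Longrightarrow> 0 < v t"
    and J: "continuous_on {0..1} J"
      "\<And>t. t \<in> {0<..<1} \<Longrightarrow> J t = (r t * \<theta>' t + v t * sin (\<theta> t))\<^sup>2 / (r t * v t)"
    and ends: "\<theta> 0 = 0" "\<theta> 1 = 2 * pi * k + pi"
begin

lemma defect_has_integral:
  "((\<lambda>t. J t - 4 * max (sin (\<theta> t)) 0 * \<theta>' t) has_integral
     integral {0..1} J - 8 * (real k + 1)) {0<..<1}"
proof -
  have "bounded (\<theta> ` {0..1})"
    by (rule compact_imp_bounded[OF compact_continuous_image[OF \<theta> compact_Icc]])
  then obtain B where "\<forall>x\<in>\<theta> ` {0..1}. norm x < B" unfolding bounded_pos_less by blast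
  then have B: "\<bar>\<theta> t\<bar> < B" if "t \<in> {0..1}" for t using that by auto
  obtain P where P: "\<And>x. \<bar>x\<bar> < B \<Longrightarrow> (P has_real_derivative max (sin x) 0) (at x)"
      "\<And>k::nat. 2 * pi * k + pi < B \<Longrightarrow> P (2 * pi * k + pi) - P 0 = 2 * (real k + 1)"
    using positive_sine_antiderivative by blast
  have "continuous_on (\<theta> ` {0..1}) P"
    by (intro continuous_at_imp_continuous_on) (auto intro!: DERIV_isCont[OF P(1)] B)
  then have "continuous_on {0..1} (\<lambda>t. 4 * P (\<theta> t))"
    by (intro continuous_intros continuous_on_compose2[OF _ \<theta>]) auto
  moreover have "((\<lambda>t. 4 * P (\<theta> t)) has_vector_derivative 4 * max (sin (\<theta> t)) 0 * \<theta>' t) (at t)"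
    if "t \<in> {0<..<1}" for t
  proof -
    have "((\<lambda>t. P (\<theta> t)) has_real_derivative max (sin (\<theta> t)) 0 * \<theta>' t) (at t)"
      using that B by (intro DERIV_chain2[OF P(1) \<theta>'(1)]) auto
    from DERIV_cmult[OF this, of 4] show ?thesis
      by (simp add: has_real_derivative_iff_has_vector_derivative mult.assoc)
  qed
  ultimately have "((\<lambda>t. 4 * max (sin (\<theta> t)) 0 * \<theta>' t) has_integral 4 * P (\<theta> 1) - 4 * P (\<theta> 0)) {0..1}"
    by (intro fundamental_theorem_of_calculus_interior) auto
  moreover have "4 * P (\<theta> 1) - 4 * P (\<theta> 0) = 8 * (real k + 1)"
    using P(2)[of k] B[of 1] ends by (simp add: abs_less_iff)
  moreover have "(J has_integral integral {0..1} J) {0..1}"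
    using J(1) by (intro integrable_integral integrable_continuous_interval)
  ultimately have "((\<lambda>t. J t - 4 * max (sin (\<theta> t)) 0 * \<theta>' t) has_integral
     integral {0..1} J - 8 * (real k + 1)) {0..1}"
    by (metis has_integral_diff)
  then show ?thesis
    using has_integral_Icc_iff_Ioo[of _ _ 0 1] by blast
qed

text \<open>Where the sine is nonnegative, the difference is a square over \<open>r v\<close> that vanishes exactly at
  umbilic points. Elsewhere the difference is \<open>J\<close> itself, which vanishes where the mean curvature does.\<close>
lemma defect_nonneg:
  assumes "t \<in> {0<..<1}"
  shows "0 \<le> J t - 4 * max (sin (\<theta> t)) 0 * \<theta>' t"
proof -
  have rv: "0 < r t * v t" using assms r(2) v by simp
  show ?thesis
  proof (cases "sin (\<theta> t) \<ge> 0")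
    case True
    have "J t - 4 * sin (\<theta> t) * \<theta>' t = (r t * \<theta>' t - v t * sin (\<theta> t))\<^sup>2 / (r t * v t)"
      unfolding J(2)[OF assms] using rv by (intro square_sum_div_minus) auto
    then show ?thesis using True rv by (simp add: max_def)
  next
    case False
    then show ?thesis using rv by (simp add: J(2)[OF assms] max_def)
  qed
qed

lemma energy_lower_bound: "8 * (real k + 1) \<le> integral {0..1} J"
  using has_integral_nonneg[OF defect_has_integral defect_nonneg] by simp

lemma energy_equality_derivative:
  assumes eq: "integral {0..1} J = 8 * (real k + 1)" and t: "t \<in> {0<..<1}"
  shows "r t * \<theta>' t = v t * \<bar>sin (\<theta> t)\<bar>"
proof -
  have "continuous_on {0<..<1} \<theta>" "continuous_on {0<..<1} J"
    using \<theta> J(1) by (auto elim: continuous_on_subset)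
  then have "J t - 4 * max (sin (\<theta> t)) 0 * \<theta>' t = 0"
    using defect_has_integral eq \<theta>'(2)
    by (intro has_integral_nonneg_eq_0[OF _ _ defect_nonneg t]) (auto intro!: continuous_intros)
  moreover have rv: "0 < r t * v t" using t r(2) v by simp
  ultimately show ?thesis
  proof (cases "sin (\<theta> t) \<ge> 0")
    case True
    have "J t - 4 * sin (\<theta> t) * \<theta>' t = (r t * \<theta>' t - v t * sin (\<theta> t))\<^sup>2 / (r t * v t)"
      unfolding J(2)[OF t] using rv by (intro square_sum_div_minus) auto
    then have "r t * \<theta>' t = v t * sin (\<theta> t)"
      using True rv r(2)[OF t] v[OF t] \<open>J t - _ = 0\<close> by (simp add: max_def)
    then show ?thesis using True by simp
  next
    case False
    then have "(r t * \<theta>' t + v t * sin (\<theta> t))\<^sup>2 / (r t * v t) = 0"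
      using rv \<open>J t - _ = 0\<close> by (simp add: J(2)[OF t] max_def)
    then show ?thesis using False rv by auto
  qed
qed

lemma angle_attained:
  assumes "0 < y" "y < \<theta> 1"
  obtains t where "t \<in> {0<..<1}" "\<theta> t = y"
proof -
  obtain t where "0 \<le> t" "t \<le> 1" "\<theta> t = y"
    using IVT'[of \<theta> 0 y 1] \<theta> assms ends by auto
  moreover from this have "t \<noteq> 0" "t \<noteq> 1" using assms ends by auto
  ultimately show thesis by (intro that[of t]) auto
qed

text \<open>Let \<open>q = sin \<theta> / r\<close>. By \<open>energy_equality_derivative\<close>, \<open>q' = v cos \<theta> (\<bar>sin \<theta>\<bar> - sin \<theta>) / r\<^sup>2\<close>, so \<open>q' = 0\<close> where
  \<open>q > 0\<close>. Thus the square of the positive part of \<open>q\<close> has derivative zero everywhere and is constant.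
  By the intermediate value theorem there is a point where \<open>\<theta> = \<pi>/2\<close>, and there \<open>q > 0\<close>. Since the sine
  is then positive in the whole interior, \<open>\<theta>\<close> cannot reach \<open>3\<pi>/2\<close>.\<close>
lemma energy_equality_round:
  assumes eq: "integral {0..1} J = 8 * (real k + 1)"
  shows "k = 0"
    and "\<exists>R>0. \<forall>t\<in>{0<..<1}. 0 < sin (\<theta> t) \<and> r t = R * sin (\<theta> t) \<and> \<theta>' t = v t / R"
proof -
  define q where "q t = sin (\<theta> t) / r t" for t
  define m where "m t = q t * \<bar>q t\<bar> + (q t)\<^sup>2" for t
  have m': "(m has_real_derivative 0) (at t)" if t: "t \<in> {0<..<1}" for t
  proof -
    \<comment> \<open>equals \<open>(cos \<theta> \<theta>' r - v sin \<theta> cos \<theta>) / r\<^sup>2\<close> by the equality case of the pointwise bound\<close>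
    define q' where "q' = cos (\<theta> t) * v t * (\<bar>sin (\<theta> t)\<bar> - sin (\<theta> t)) / (r t * r t)"
    have "(q has_real_derivative
        (cos (\<theta> t) * \<theta>' t * r t - sin (\<theta> t) * (v t * cos (\<theta> t))) / (r t * r t)) (at t)"
      unfolding q_def using r(2)[OF t]
      by (intro DERIV_divide r(1)[OF t] DERIV_fun_sin \<theta>'(1)[OF t]) auto
    moreover have "cos (\<theta> t) * \<theta>' t * r t - sin (\<theta> t) * (v t * cos (\<theta> t))
        = cos (\<theta> t) * v t * (\<bar>sin (\<theta> t)\<bar> - sin (\<theta> t))"
      using energy_equality_derivative[OF eq t] by (simp add: algebra_simps)
    ultimately have q': "(q has_real_derivative q') (at t)" by (simp add: q'_def)
    have "(m has_real_derivative 2 * \<bar>q t\<bar> * q' + 2 * q t * q') (at t)"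
      unfolding m_def
      by (intro DERIV_add DERIV_chain2[OF has_real_derivative_self_times_abs q'])
         (use DERIV_power[OF q', of 2] in \<open>simp add: mult_ac\<close>)
    moreover have "2 * \<bar>q t\<bar> * q' + 2 * q t * q' = 0"
      using r(2)[OF t]
      by (cases "sin (\<theta> t) \<ge> 0") (auto simp: q_def q'_def abs_if divide_neg_pos)
    ultimately show ?thesis by metis
  qed
  obtain t\<^sub>1 where t\<^sub>1: "t\<^sub>1 \<in> {0<..<1}" "\<theta> t\<^sub>1 = pi / 2"
  proof (rule angle_attained)
    have "0 \<le> 2 * pi * real k" by simp
    then show "pi / 2 < \<theta> 1" using pi_gt_zero ends(2) by linarith
  qed auto
  define R where "R = r t\<^sub>1"
  have R: "0 < R" using r(2) t\<^sub>1 by (simp add: R_def)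
  have "m t = m t\<^sub>1" if "t \<in> {0<..<1}" for t
    by (rule zero_derivative_imp_eq[OF _ m' that t\<^sub>1(1)]) auto
  then have m: "m t = 2 / R\<^sup>2" if "t \<in> {0<..<1}" for t
    using that t\<^sub>1 R by (simp add: m_def q_def R_def power2_eq_square)
  have q: "q t = 1 / R" if t: "t \<in> {0<..<1}" for t
  proof -
    have "0 < q t"
    proof (rule ccontr)
      assume "\<not> 0 < q t"
      then have "m t = 0" by (simp add: m_def abs_if power2_eq_square)
      then show False using m[OF t] R by simp
    qed
    moreover from this have "(q t)\<^sup>2 = (1 / R)\<^sup>2"
      using m[OF t] by (simp add: m_def power2_eq_square)
    ultimately show ?thesis using R by (simp add: power2_eq_iff_nonneg)
  qed
  have pos: "0 < sin (\<theta> t)" and rt: "r t = R * sin (\<theta> t)" if t: "t \<in> {0<..<1}" for t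
  proof -
    show "0 < sin (\<theta> t)"
      using q[OF t] R r(2)[OF t] by (metis q_def zero_less_divide_1_iff zero_less_divide_iff not_less_iff_gr_or_eq)
    show "r t = R * sin (\<theta> t)"
      using q[OF t] R r(2)[OF t] by (simp add: q_def field_simps)
  qed
  have "\<theta>' t = v t / R" if t: "t \<in> {0<..<1}" for t
    using energy_equality_derivative[OF eq t] pos[OF t] rt[OF t] R by (simp add: field_simps)
  then show "\<exists>R>0. \<forall>t\<in>{0<..<1}. 0 < sin (\<theta> t) \<and> r t = R * sin (\<theta> t) \<and> \<theta>' t = v t / R"
    using pos rt R by blast
  show "k = 0"
  proof (rule ccontr)
    assume "k \<noteq> 0"
    then have "1 \<le> real k" by simp
    then have "2 * pi * 1 \<le> 2 * pi * real k" by (intro mult_left_mono) auto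
    then have "3 / 2 * pi < \<theta> 1" using ends(2) pi_gt_zero by linarith
    then obtain t where t: "t \<in> {0<..<1}" "\<theta> t = 3 / 2 * pi"
      using angle_attained[of "3 / 2 * pi"] by auto
    have "sin (3 / 2 * pi) = - 1" using sin_3over2_pi by simp
    then show False using pos[OF t(1)] unfolding t(2) by simp
  qed
qed

end

text \<open>Reflecting the curve at a plane orthogonal to the axis replaces \<open>\<theta>\<close> by \<open>-\<theta>\<close> and changes neither \<open>r\<close> nor
  \<open>J\<close>. The angle \<open>\<alpha>\<close> is \<open>\<theta> - \<theta> 0\<close>, reflected if the turning number is negative.\<close>
lemma profile_energy:
  fixes \<theta> \<theta>' r v J :: "real \<Rightarrow> real"
  assumes \<theta>: "continuous_on {0..1} \<theta>"
    and \<theta>': "\<And>t. t \<in> {0<..<1} \<Longrightarrow> (\<theta> has_real_derivative \<theta>' t) (at t)" "continuous_on {0<..<1} \<theta>'"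
    and r: "\<And>t. t \<in> {0<..<1} \<Longrightarrow> (r has_real_derivative v t * cos (\<theta> t)) (at t)"
      "\<And>t. t \<in> {0<..<1} \<Longrightarrow> 0 < r t"
    and v: "\<And>t. t \<in> {0<..<1} \<Longrightarrow> 0 < v t"
    and J: "continuous_on {0..1} J"
      "\<And>t. t \<in> {0<..<1} \<Longrightarrow> J t = (r t * \<theta>' t + v t * sin (\<theta> t))\<^sup>2 / (r t * v t)"
    and start: "cos (\<theta> 0) = 1"
    and \<tau>: "\<theta> 1 - \<theta> 0 = 2 * pi * \<tau>" "\<tau> = of_int j + 1 / 2"
  shows "8 * (\<bar>\<tau>\<bar> + 1 / 2) \<le> integral {0..1} J"
    and "integral {0..1} J = 8 * (\<bar>\<tau>\<bar> + 1 / 2) \<Longrightarrow>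
      \<exists>\<sigma> R \<alpha>. \<sigma> \<in> {-1, 1} \<and> 0 < R \<and> continuous_on {0..1} \<alpha> \<and> \<alpha> 0 = 0 \<and> \<alpha> 1 = pi \<and>
        (\<forall>t\<in>{0<..<1}. (\<alpha> has_real_derivative v t / R) (at t) \<and> r t = R * sin (\<alpha> t)
            \<and> sin (\<theta> t) = \<sigma> * sin (\<alpha> t))"
proof -
  define \<sigma> :: real where "\<sigma> = (if 0 \<le> j then 1 else -1)"
  define k where "k = nat (if 0 \<le> j then j else - j - 1)"
  define \<alpha> where "\<alpha> t = \<sigma> * (\<theta> t - \<theta> 0)" for t
  have \<sigma>: "\<sigma> \<in> {-1, 1}" "\<sigma> * \<sigma> = 1" by (auto simp: \<sigma>_def)
  have k: "\<bar>\<tau>\<bar> + 1 / 2 = real k + 1" "\<sigma> * \<tau> = real k + 1 / 2"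
    using \<tau>(2) by (auto simp: k_def \<sigma>_def)
  have "sin (\<theta> 0) = 0" using start sin_cos_squared_add[of "\<theta> 0"] by simp
  then have trig: "cos (\<alpha> t) = cos (\<theta> t)" "sin (\<alpha> t) = \<sigma> * sin (\<theta> t)" for t
    using start by (auto simp: \<alpha>_def \<sigma>_def cos_diff sin_diff)
  have a: "continuous_on {0..1} \<alpha>" unfolding \<alpha>_def by (intro continuous_intros \<theta>)
  have a': "(\<alpha> has_real_derivative \<sigma> * \<theta>' t) (at t)" if "t \<in> {0<..<1}" for t
    unfolding \<alpha>_def using \<theta>'(1)[OF that] by (auto intro!: derivative_eq_intros)
  have ca': "continuous_on {0<..<1} (\<lambda>t. \<sigma> * \<theta>' t)" by (intro continuous_intros \<theta>')
  have r': "(r has_real_derivative v t * cos (\<alpha> t)) (at t)" if "t \<in> {0<..<1}" for t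
    using r(1)[OF that] by (simp add: trig)
  have J': "J t = (r t * (\<sigma> * \<theta>' t) + v t * sin (\<alpha> t))\<^sup>2 / (r t * v t)" if "t \<in> {0<..<1}" for t
  proof -
    have "(r t * (\<sigma> * \<theta>' t) + v t * sin (\<alpha> t)) = \<sigma> * (r t * \<theta>' t + v t * sin (\<theta> t))"
      by (simp add: trig algebra_simps)
    then show ?thesis using J(2)[OF that] \<sigma> by (simp add: power_mult_distrib power2_eq_square)
  qed
  have ends: "\<alpha> 0 = 0" "\<alpha> 1 = 2 * pi * k + pi"
  proof -
    have "\<alpha> 1 = 2 * pi * (\<sigma> * \<tau>)" by (simp add: \<alpha>_def \<tau>(1))
    then show "\<alpha> 1 = 2 * pi * k + pi" unfolding k(2) by (simp add: algebra_simps)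
  qed (simp add: \<alpha>_def)
  note prems = a a' ca' r' r(2) v J(1) J' ends
  show "8 * (\<bar>\<tau>\<bar> + 1 / 2) \<le> integral {0..1} J"
    unfolding k(1) by (rule energy_lower_bound[OF prems])
  assume "integral {0..1} J = 8 * (\<bar>\<tau>\<bar> + 1 / 2)"
  then have eq: "integral {0..1} J = 8 * (real k + 1)" unfolding k(1) .
  have "k = 0" by (rule energy_equality_round(1)[OF prems eq])
  moreover obtain R where "0 < R"
    "\<forall>t\<in>{0<..<1}. 0 < sin (\<alpha> t) \<and> r t = R * sin (\<alpha> t) \<and> \<sigma> * \<theta>' t = v t / R"
    using energy_equality_round(2)[OF prems eq] by blast
  moreover have "sin (\<theta> t) = \<sigma> * sin (\<alpha> t)" for t
    using \<sigma>(2) by (simp add: trig mult.assoc[symmetric])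
  ultimately show "\<exists>\<sigma> R \<alpha>. \<sigma> \<in> {-1, 1} \<and> 0 < R \<and> continuous_on {0..1} \<alpha> \<and> \<alpha> 0 = 0 \<and> \<alpha> 1 = pi \<and>
        (\<forall>t\<in>{0<..<1}. (\<alpha> has_real_derivative v t / R) (at t) \<and> r t = R * sin (\<alpha> t)
            \<and> sin (\<theta> t) = \<sigma> * sin (\<alpha> t))"
    using \<sigma>(1) a ends a' by (intro exI[of _ \<sigma>] exI[of _ R] exI[of _ \<alpha>]) auto
qed

section \<open>Generating curves and the inequality\<close>

lemma generating_curve_profile:
  assumes "generating_curve c"
  obtains r h r' h' r'' h'' :: "real \<Rightarrow> real"
  where "\<And>t. t \<in> {0..1} \<Longrightarrow> (r has_real_derivative r' t) (at t)"
    "\<And>t. t \<in> {0..1} \<Longrightarrow> (h has_real_derivative h' t) (at t)"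
    "\<And>t. t \<in> {0..1} \<Longrightarrow> (r' has_real_derivative r'' t) (at t)"
    "\<And>t. t \<in> {0..1} \<Longrightarrow> (h' has_real_derivative h'' t) (at t)"
    "continuous_on {0..1} r''" "continuous_on {0..1} h''"
    "\<And>t. t \<in> {0..1} \<Longrightarrow> c t = (r t, h t)"
    "\<And>t. t \<in> {0..1} \<Longrightarrow> velocity c t = (r' t, h' t)"
proof -
  obtain U g where U: "open U" "{0..1} \<subseteq> U" and g: "\<And>k. Ck_on k U g"
    and eq: "\<And>t. t \<in> {0..1} \<Longrightarrow> g t = c t"
    using assms unfolding generating_curve_def smooth_on_def by blast
  define g1 where "g1 t = frechet_derivative g (at t) 1" for t
  define g2 where "g2 t = frechet_derivative g1 (at t) 1" for t
  have "Ck_on k U g1" for k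
    unfolding g1_def by (rule Ck_on_Suc_derivative[OF g])
  note g1 = this
  have D: "(k has_vector_derivative frechet_derivative k (at t) 1) (at t)"
    if k: "Ck_on (Suc 0) U k" and t: "t \<in> {0..1}" for k :: "real \<Rightarrow> real \<times> real" and t
  proof -
    have D: "(k has_derivative frechet_derivative k (at t)) (at t)"
      using U t by (intro Ck_on_Suc_has_derivative[OF k]) auto
    have "frechet_derivative k (at t) s = s *\<^sub>R frechet_derivative k (at t) 1" for s
      using linear_scale[OF has_derivative_linear[OF D], of s 1] by simp
    then have "frechet_derivative k (at t) = (\<lambda>s. s *\<^sub>R frechet_derivative k (at t) 1)" by (rule ext)
    with D show ?thesis by (simp add: has_vector_derivative_def)
  qed
  have Dg: "(g has_vector_derivative g1 t) (at t)" "(g1 has_vector_derivative g2 t) (at t)"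
    if "t \<in> {0..1}" for t
    unfolding g2_def g1_def[of t] using D[OF g that] D[OF g1 that] by simp_all
  have fs: "((\<lambda>s. fst (k s)) has_real_derivative fst k') (at t)"
    "((\<lambda>s. snd (k s)) has_real_derivative snd k') (at t)"
    if "(k has_vector_derivative k') (at t)" for k :: "real \<Rightarrow> real \<times> real" and k' t
    using bounded_linear.has_vector_derivative[OF bounded_linear_fst that]
      bounded_linear.has_vector_derivative[OF bounded_linear_snd that]
    by (simp_all add: has_real_derivative_iff_has_vector_derivative)
  have "Ck_on 0 U g2"
    unfolding g2_def by (rule Ck_on_Suc_derivative[OF g1])
  then have cont: "continuous_on {0..1} g2" using U(2) by (auto elim: continuous_on_subset)
  have vel: "velocity c t = g1 t" if t: "t \<in> {0..1}" for t
  proof -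
    have "(g has_vector_derivative g1 t) (at t within {0..1})"
      using Dg(1)[OF t] by (rule has_vector_derivative_at_within)
    then have "(c has_vector_derivative g1 t) (at t within {0..1})"
      by (rule has_vector_derivative_transform[rotated 2]) (use t eq in auto)
    then show ?thesis
      unfolding velocity_def using t by (intro vector_derivative_within_closed_interval) auto
  qed
  show thesis
  proof (rule that)
    show "((\<lambda>s. fst (g s)) has_real_derivative fst (g1 t)) (at t)"
      "((\<lambda>s. snd (g s)) has_real_derivative snd (g1 t)) (at t)"
      "((\<lambda>s. fst (g1 s)) has_real_derivative fst (g2 t)) (at t)"
      "((\<lambda>s. snd (g1 s)) has_real_derivative snd (g2 t)) (at t)" if "t \<in> {0..1}" for t
      using fs Dg[OF that] by blast+
    show "continuous_on {0..1} (\<lambda>t. fst (g2 t))" "continuous_on {0..1} (\<lambda>t. snd (g2 t))"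
      using cont by (auto intro: continuous_intros)
    show "c t = (fst (g t), snd (g t))" if "t \<in> {0..1}" for t using eq[OF that] by simp
    show "velocity c t = (fst (g1 t), snd (g1 t))" if "t \<in> {0..1}" for t using vel[OF that] by simp
  qed
qed

text \<open>At an end point both numerator and denominator vanish, and the quotient of the difference quotients tends
  to the quotient of the derivatives.\<close>
lemma continuous_on_quotient_extension:
  fixes g r g' r' :: "real \<Rightarrow> real"
  assumes g: "\<And>t. t \<in> {0..1} \<Longrightarrow> (g has_real_derivative g' t) (at t)"
    and r: "\<And>t. t \<in> {0..1} \<Longrightarrow> (r has_real_derivative r' t) (at t)"
    and nz: "\<And>t. t \<in> {0<..<1} \<Longrightarrow> r t \<noteq> 0"
    and ends: "\<And>t. t \<in> {0, 1} \<Longrightarrow> g t = 0 \<and> r t = 0 \<and> r' t \<noteq> 0"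
  shows "continuous_on {0..1} (\<lambda>t. if t \<in> {0<..<1} then g t / r t else g' t / r' t)"
    (is "continuous_on _ ?q")
  unfolding continuous_on_def
proof
  fix t :: real assume t: "t \<in> {0..1}"
  show "(?q \<longlongrightarrow> ?q t) (at t within {0..1})"
  proof (cases "t \<in> {0<..<1}")
    case True
    have "((\<lambda>s. g s / r s) \<longlongrightarrow> g t / r t) (at t)"
      using DERIV_isCont[OF g[OF t]] DERIV_isCont[OF r[OF t]] nz[OF True]
      by (intro tendsto_divide) (auto simp: isCont_def)
    then have "((\<lambda>s. g s / r s) \<longlongrightarrow> ?q t) (at t within {0..1})"
      using True tendsto_within_subset[of "\<lambda>s. g s / r s" _ t UNIV "{0..1}"] by simp
    moreover have "eventually (\<lambda>s. s \<in> {0<..<1}) (at t within {0..1})"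
      using eventually_nhds_in_open[of "{0<..<1}" t] True
      by (simp add: eventually_at_filter eventually_mono)
    then have "eventually (\<lambda>s. g s / r s = ?q s) (at t within {0..1})"
      by (rule eventually_mono) simp
    ultimately show ?thesis by (rule Lim_transform_eventually)
  next
    case False
    then have side: "t = 0 \<or> t = 1" using t by auto
    then have e: "g t = 0" "r t = 0" "r' t \<noteq> 0" using ends[of t] by auto
    have "((\<lambda>s. ((g s - g t) / (s - t)) / ((r s - r t) / (s - t))) \<longlongrightarrow> g' t / r' t) (at t)"
      using g[OF t] r[OF t] e(3) by (intro tendsto_divide) (auto simp: has_field_derivative_iff)
    from tendsto_within_subset[OF this subset_UNIV, of "{0..1}"]
    have "((\<lambda>s. ((g s - g t) / (s - t)) / ((r s - r t) / (s - t))) \<longlongrightarrow> ?q t) (at t within {0..1})"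
      unfolding if_not_P[OF False] .
    moreover have "eventually (\<lambda>s. s \<in> {0<..<1}) (at t within {0..1})"
      unfolding eventually_at using side by (intro exI[of _ 1]) (auto simp: dist_real_def)
    then have "eventually (\<lambda>s. ((g s - g t) / (s - t)) / ((r s - r t) / (s - t)) = ?q s) (at t within {0..1})"
      by (rule eventually_mono) (use side e in auto)
    ultimately show ?thesis by (rule Lim_transform_eventually)
  qed
qed

theorem proposition1p10:
  fixes f :: "real^3 \<Rightarrow> real^3" and c :: "real \<Rightarrow> real \<times> real" and \<tau> :: real
  assumes "sphere_of_revolution f c"
    and "has_turning_number c \<tau>"
    and "\<exists>k::int. \<tau> = of_int k + 1/2"
    and "\<not> round_sphere f"
  shows "willmore f > 4 * pi * (\<bar>\<tau>\<bar> + 1/2)"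
proof -
  obtain \<Phi> where imm: "sphere_immersion f" and gen: "generating_curve c"
    and polar: "polar_parametrization \<Phi>"
    and profile: "\<And>t \<phi>. t \<in> {0..1} \<Longrightarrow>
      f (\<Phi> (t, \<phi>)) = vector [fst (c t) * cos \<phi>, fst (c t) * sin \<phi>, snd (c t)]"
    using assms(1) unfolding sphere_of_revolution_def by blast
  obtain r h r' h' r'' h'' where D:
    "\<And>t. t \<in> {0..1} \<Longrightarrow> (r has_real_derivative r' t) (at t)"
    "\<And>t. t \<in> {0..1} \<Longrightarrow> (h has_real_derivative h' t) (at t)"
    "\<And>t. t \<in> {0..1} \<Longrightarrow> (r' has_real_derivative r'' t) (at t)"
    "\<And>t. t \<in> {0..1} \<Longrightarrow> (h' has_real_derivative h'' t) (at t)"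
    "continuous_on {0..1} r''" "continuous_on {0..1} h''"
    and c: "\<And>t. t \<in> {0..1} \<Longrightarrow> c t = (r t, h t)"
    and vel: "\<And>t. t \<in> {0..1} \<Longrightarrow> velocity c t = (r' t, h' t)"
  proof (rule generating_curve_profile[OF gen], goal_cases)
    case (1 r h r' h' r'' h'')
    from 1(2-9) show thesis by (rule 1(1))
  qed
  have axis: "r 0 = 0" "r 1 = 0" "h' 0 = 0" "h' 1 = 0"
    using gen c[of 0] c[of 1] vel[of 0] vel[of 1] by (auto simp: generating_curve_def)
  have r_pos: "0 < r t" if "t \<in> {0<..<1}" for t
  proof -
    have "0 < fst (c t)" using gen that unfolding generating_curve_def by blast
    then show ?thesis using c[of t] that by simp
  qed
  have reg: "r' t \<noteq> 0 \<or> h' t \<noteq> 0" if "t \<in> {0..1}" for t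
    using gen vel[OF that] that by (auto simp: generating_curve_def zero_prod_def)
  interpret polar_parametrized_sphere \<Phi> using polar by unfold_locales
  interpret revolution \<Phi> f r h r' h' r'' h''
  proof
    show "smooth_on (sphere 0 1) f" using imm by (simp add: sphere_immersion_def)
    show "f (\<Phi> (t, \<phi>)) = vector [r t * cos \<phi>, r t * sin \<phi>, h t]" if "t \<in> {0..1}" for t \<phi>
      using profile[OF that] c[OF that] by simp
    show "continuous_on {0<..<1} r''" "continuous_on {0<..<1} h''"
      using D(5,6) by (auto elim: continuous_on_subset)
  qed (use D r_pos reg in auto)

  obtain \<theta> where \<theta>: "continuous_on {0..1} \<theta>"
    and lift: "\<And>t. t \<in> {0..1} \<Longrightarrow> velocity c t = norm (velocity c t) *\<^sub>R (cos (\<theta> t), sin (\<theta> t))"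
    and \<tau>: "\<theta> 1 - \<theta> 0 = 2 * pi * \<tau>"
    using assms(2) unfolding has_turning_number_def by auto
  have angle: "r' t = speed t * cos (\<theta> t)" "h' t = speed t * sin (\<theta> t)" if "t \<in> {0..1}" for t
    using lift[OF that] unfolding vel[OF that] by (simp_all add: norm_Pair speed_def)
  have speed: "0 < speed t" if "t \<in> {0..1}" for t
    using reg[OF that] by (auto simp: speed_def sum_power2_gt_zero_iff)
  \<comment> \<open>the curve leaves the axis into the half plane \<open>r > 0\<close>, hence in the direction of \<open>+r\<close>\<close>
  have start: "cos (\<theta> 0) = 1"
  proof -
    have "sin (\<theta> 0) = 0" using angle(2)[of 0] axis speed[of 0] by simp
    have "\<not> r' 0 < 0"
    proof
      assume "r' 0 < 0"
      then obtain d where "0 < d" "\<And>s. 0 < s \<Longrightarrow> s < d \<Longrightarrow> r (0 + s) < r 0"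
        using DERIV_neg_dec_right[OF D(1)[of 0]] by auto
      then have "r (min (d / 2) (1 / 2)) < 0" using axis(1) by (auto simp: min_def)
      moreover have "0 < r (min (d / 2) (1 / 2))" using \<open>0 < d\<close> by (intro r_pos) (auto simp: min_def)
      ultimately show False by simp
    qed
    then have "0 \<le> cos (\<theta> 0)" using angle(1)[of 0] speed[of 0] by (simp add: zero_le_mult_iff not_less)
    moreover have "(cos (\<theta> 0))\<^sup>2 = 1" using sin_cos_squared_add[of "\<theta> 0"] \<open>sin (\<theta> 0) = 0\<close> by simp
    ultimately show ?thesis by (simp add: power2_eq_1_iff)
  qed
  have \<theta>': "(\<theta> has_real_derivative turning_rate t) (at t)" if t: "t \<in> {0<..<1}" for t
  proof -
    have t': "t \<in> {0..1}" using t by simp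
    have pos: "0 < (r' t)\<^sup>2 + (h' t)\<^sup>2" using reg[OF t'] by (simp add: sum_power2_gt_zero_iff)
    define v' where "v' = inverse (sqrt ((r' t)\<^sup>2 + (h' t)\<^sup>2)) / 2 * (2 * (r'' t * r' t) + 2 * (h'' t * h' t))"
    have "((\<lambda>t. (r' t)\<^sup>2 + (h' t)\<^sup>2) has_real_derivative 2 * (r'' t * r' t) + 2 * (h'' t * h' t)) (at t)"
      using DERIV_add[OF DERIV_power[OF D(3)[OF t'], of 2] DERIV_power[OF D(4)[OF t'], of 2]]
      by (simp add: mult_ac)
    then have v': "(speed has_real_derivative v') (at t)"
      unfolding speed_def[abs_def] v'_def using pos by (intro DERIV_chain2[OF DERIV_real_sqrt]) auto
    have nz: "speed t \<noteq> 0" using speed[OF t'] by simp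
    have "isCont \<theta> t"
      using \<theta> t by (intro continuous_on_interior[of "{0..1}"]) (auto simp: interior_atLeastAtMost_real)
    moreover have "eventually (\<lambda>s. s \<in> {0<..<1}) (nhds t)"
      using t by (intro eventually_nhds_in_open) auto
    then have "eventually (\<lambda>s. cos (\<theta> s) = r' s / speed s \<and> sin (\<theta> s) = h' s / speed s) (nhds t)"
    proof (rule eventually_mono)
      fix s :: real assume "s \<in> {0<..<1}"
      then have "s \<in> {0..1}" by simp
      then show "cos (\<theta> s) = r' s / speed s \<and> sin (\<theta> s) = h' s / speed s"
        using angle[of s] speed[of s] by simp
    qed
    ultimately have "(\<theta> has_real_derivative
        r' t / speed t * ((h'' t * speed t - h' t * v') / (speed t * speed t))
        - h' t / speed t * ((r'' t * speed t - r' t * v') / (speed t * speed t))) (at t)"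
      by (rule angle_has_derivative[OF _ _ DERIV_divide[OF D(3)[OF t'] v' nz] DERIV_divide[OF D(4)[OF t'] v' nz]])
    moreover have "r' t / speed t * ((h'' t * speed t - h' t * v') / (speed t * speed t))
        - h' t / speed t * ((r'' t * speed t - r' t * v') / (speed t * speed t)) = turning_rate t"
      unfolding turning_rate_def using nz by (simp add: field_simps power2_eq_square)
    ultimately show ?thesis by simp
  qed

  \<comment> \<open>\<open>q\<close> continues \<open>h' / r\<close> to the poles. Expanding the square in the energy density and replacing
    \<open>h'\<^sup>2 / r\<close> by \<open>h' q\<close> leaves an expression without \<open>r\<close> in a denominator.\<close>
  define q where "q t = (if t \<in> {0<..<1} then h' t / r t else h'' t / r' t)" for t
  define J where "J t = (r t * (turning_rate t)\<^sup>2 + 2 * turning_rate t * h' t + h' t * q t) / speed t" for t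
  have cont: "continuous_on {0..1} r" "continuous_on {0..1} r'" "continuous_on {0..1} h'"
    "continuous_on {0..1} h"
    by (intro continuous_at_imp_continuous_on ballI DERIV_isCont; erule D)+
  have cont_speed: "continuous_on {0..1} speed"
    unfolding speed_def[abs_def] by (intro continuous_intros cont)
  have cont_\<kappa>: "continuous_on {0..1} turning_rate"
    unfolding turning_rate_def[abs_def]
    using speed by (intro continuous_intros cont cont_speed D) (fastforce)
  have cont_q: "continuous_on {0..1} q"
    unfolding q_def[abs_def]
    using reg[of 0] reg[of 1] axis r_pos
    by (intro continuous_on_quotient_extension D) force+
  have J: "continuous_on {0..1} J"
    unfolding J_def[abs_def] using speed
    by (intro continuous_intros cont cont_speed cont_\<kappa> cont_q) fastforce
  have J_eq: "J t = (r t * turning_rate t + h' t)\<^sup>2 / (r t * speed t)" if t: "t \<in> {0<..<1}" for t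
  proof -
    have "(r t * turning_rate t + h' t)\<^sup>2
        = r t * (r t * (turning_rate t)\<^sup>2 + 2 * turning_rate t * h' t + h' t * q t)"
      using r_pos[OF t] t by (simp add: q_def power2_eq_square algebra_simps)
    then show ?thesis using r_pos[OF t] by (simp add: J_def)
  qed
  have J_eq': "J t = (r t * turning_rate t + speed t * sin (\<theta> t))\<^sup>2 / (r t * speed t)"
    if t: "t \<in> {0<..<1}" for t
    using J_eq[OF t] angle(2)[of t] t by simp
  have willmore: "willmore f = pi / 2 * integral {0..1} J"
    by (rule willmore_revolution[OF J J_eq])

  obtain j :: int where j: "\<tau> = of_int j + 1 / 2" using assms(3) by blast
  have cont_\<kappa>': "continuous_on {0<..<1} turning_rate"
    using cont_\<kappa> by (rule continuous_on_subset) auto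
  have r_deriv: "(r has_real_derivative speed t * cos (\<theta> t)) (at t)" if "t \<in> {0<..<1}" for t
    using D(1)[of t] angle(1)[of t] that by simp
  note profile_data = \<theta> \<theta>' cont_\<kappa>' r_deriv r_pos speed_pos J J_eq' start \<tau> j
  have "integral {0..1} J \<noteq> 8 * (\<bar>\<tau>\<bar> + 1 / 2)"
  proof
    assume eq: "integral {0..1} J = 8 * (\<bar>\<tau>\<bar> + 1 / 2)"
    have "\<exists>\<sigma> R \<alpha>. \<sigma> \<in> {-1, 1} \<and> 0 < R \<and> continuous_on {0..1} \<alpha> \<and> \<alpha> 0 = 0 \<and> \<alpha> 1 = pi \<and>
        (\<forall>t\<in>{0<..<1}. (\<alpha> has_real_derivative speed t / R) (at t) \<and> r t = R * sin (\<alpha> t)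
            \<and> sin (\<theta> t) = \<sigma> * sin (\<alpha> t))"
      by (rule profile_energy(2)[OF profile_data eq])
    then obtain \<sigma> R \<alpha> where \<sigma>: "\<sigma> \<in> {-1, 1}" and R: "0 < R"
      and \<alpha>: "continuous_on {0..1} \<alpha>" "\<alpha> 0 = 0" "\<alpha> 1 = pi"
      and \<alpha>': "\<And>t. t \<in> {0<..<1} \<Longrightarrow> (\<alpha> has_real_derivative speed t / R) (at t)"
      and r_eq: "\<And>t. t \<in> {0<..<1} \<Longrightarrow> r t = R * sin (\<alpha> t)"
      and sin_eq: "\<And>t. t \<in> {0<..<1} \<Longrightarrow> sin (\<theta> t) = \<sigma> * sin (\<alpha> t)"
      by blast
    have mono: "strict_mono_on {0..1} \<alpha>"
    proof (rule strict_mono_onI)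
      fix s t :: real assume st: "s \<in> {0..1}" "t \<in> {0..1}" "s < t"
      show "\<alpha> s < \<alpha> t"
      proof (rule DERIV_pos_imp_increasing_open[OF st(3)])
        fix x assume "s < x" "x < t"
        then have "x \<in> {0<..<1}" using st by auto
        then show "\<exists>y. (\<alpha> has_real_derivative y) (at x) \<and> 0 < y"
          using \<alpha>' speed_pos R by (intro exI[of _ "speed x / R"]) auto
      next
        show "continuous_on {s..t} \<alpha>" using \<alpha>(1) st by (auto elim: continuous_on_subset)
      qed
    qed
    have r_eq': "r t = R * sin (\<alpha> t)" if "t \<in> {0..1}" for t
      using r_eq[of t] that axis \<alpha> by (cases "t = 0"; cases "t = 1") auto
    \<comment> \<open>\<open>h + \<sigma> R cos \<alpha>\<close> is the height of the centre of the circle\<close>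
    have "((\<lambda>t. h t + \<sigma> * R * cos (\<alpha> t)) has_real_derivative 0) (at t)" if t: "t \<in> {0<..<1}" for t
    proof -
      have "((\<lambda>t. h t + \<sigma> * R * cos (\<alpha> t)) has_real_derivative
          h' t + \<sigma> * R * (- sin (\<alpha> t) * (speed t / R))) (at t)"
        using D(2)[of t] t by (intro DERIV_add DERIV_cmult DERIV_fun_cos \<alpha>') auto
      moreover have "h' t + \<sigma> * R * (- sin (\<alpha> t) * (speed t / R)) = 0"
        using angle(2)[of t] sin_eq[OF t] t R by simp
      ultimately show ?thesis by simp
    qed
    moreover have "continuous_on {0..1} (\<lambda>t. h t + \<sigma> * R * cos (\<alpha> t))"
      by (intro continuous_intros cont \<alpha>)
    ultimately have "h t + \<sigma> * R * cos (\<alpha> t) = h 0 + \<sigma> * R * cos (\<alpha> 0)" if "t \<in> {0..1}" for t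
      using that DERIV_isconst2[of 0 1 "\<lambda>t. h t + \<sigma> * R * cos (\<alpha> t)" t] by auto
    then have h_eq: "h t = (h 0 + \<sigma> * R) - \<sigma> * R * cos (\<alpha> t)" if "t \<in> {0..1}" for t
      using that \<alpha>(2) by (metis add_diff_cancel_right' cos_zero mult.right_neutral)
    have "round_sphere f"
    proof (rule semicircle_profile_imp_round[OF imm R \<sigma> \<alpha>(1) mono \<alpha>(2,3)])
      show "f (\<Phi> (t, \<phi>)) = vector [R * sin (\<alpha> t) * cos \<phi>, R * sin (\<alpha> t) * sin \<phi>,
          (h 0 + \<sigma> * R) - \<sigma> * R * cos (\<alpha> t)]" if "t \<in> {0..1}" for t \<phi>
        using profile[OF that] c[OF that] r_eq'[OF that] h_eq[OF that] by simp
    qed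
    then show False using assms(4) by simp
  qed
  moreover have "8 * (\<bar>\<tau>\<bar> + 1 / 2) \<le> integral {0..1} J"
    by (rule profile_energy(1)[OF profile_data])
  ultimately have "8 * (\<bar>\<tau>\<bar> + 1 / 2) < integral {0..1} J" by simp
  then have "pi / 2 * (8 * (\<bar>\<tau>\<bar> + 1 / 2)) < pi / 2 * integral {0..1} J"
    by (intro mult_strict_left_mono) auto
  then show ?thesis unfolding willmore by (simp add: algebra_simps)
qed

end
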